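(* For each infinite set $T \subseteq \mathbb{N}^+$ and each natural number $k \ge 1$, $\mathrm{UP}_{\le k} \subseteq \mathrm{RC}_T$.
   Context: For an NPTM (nondeterministic polynomial-time Turing machine) $N$ and string $x$, $\#\mathrm{acc}_N(x)$ is the number of accepting computation paths of $N$ on input $x$. For $S \subseteq \mathbb{N}^+$, $\mathrm{RC}_S$ is the class of languages $L$ for which there is an NPTM $N$ such that for every string $x$: if $x \notin L$ then $\#\mathrm{acc}_N(x)=0$, and if $x \in L$ then $\#\mathrm{acc}_N(x) \in S$. For $k \in \mathbb{N}^+$, $\mathrm{UP}_{\le k}$ is the class of languages $L$ for which there is an NPTM $N$ such that for every $x$: if $x \notin L$ then $\#\mathrm{acc}_N(x)=0$, and if $x \in L$ then $1 \le \#\mathrm{acc}_N(x) \le k$. *)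

theory Defs
  imports Main "HOL-Computational_Algebra.Polynomial"
begin

text \<open>
  Nondeterministic multitape Turing machines over the input alphabet \<open>bool\<close>. Each tape is
  infinite in both directions, with cells indexed by the integers.
\<close>

datatype 'g symbol = Blank | Bit bool | Aux 'g

datatype dir = Left | Stay | Right

fun offset :: "dir \<Rightarrow> int" where
  "offset Left = -1"
| "offset Stay = 0"
| "offset Right = 1"

text \<open>
  A transition \<open>(q, rs, q', as)\<close> is enabled in state \<open>q\<close> if the heads read \<open>rs\<close>; it leads to
  state \<open>q'\<close>, and on the \<open>i\<close>-th tape it writes the symbol \<open>fst (as ! i)\<close> and then moves the head
  in the direction \<open>snd (as ! i)\<close>.
\<close>

type_synonym ('q, 'g) transition =
  "'q \<times> 'g symbol list \<times> 'q \<times> ('g symbol \<times> dir) list"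

record ('q, 'g) ntm =
  tapes :: nat
  states :: "'q set"
  aux :: "'g set"
  start :: 'q
  accepting :: "'q set"
  trans :: "('q, 'g) transition set"

definition alphabet :: "('q, 'g) ntm \<Rightarrow> 'g symbol set" where
  "alphabet N = {Blank, Bit False, Bit True} \<union> Aux ` aux N"

definition ntm :: "('q, 'g) ntm \<Rightarrow> bool" where
  "ntm N \<longleftrightarrow> tapes N \<ge> 1 \<and> finite (states N) \<and> finite (aux N) \<and>
     start N \<in> states N \<and> accepting N \<subseteq> states N \<and>
     (\<forall>(q, rs, q', as) \<in> trans N. q \<in> states N \<and> q' \<in> states N \<and>
        length rs = tapes N \<and> set rs \<subseteq> alphabet N \<and>
        length as = tapes N \<and> fst ` set as \<subseteq> alphabet N)"

text \<open>A tape consists of its contents and the position of its head.\<close>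

type_synonym 'g tape = "(int \<Rightarrow> 'g symbol) \<times> int"

type_synonym ('q, 'g) config = "'q \<times> 'g tape list"

fun read :: "'g tape \<Rightarrow> 'g symbol" where
  "read (f, h) = f h"

fun act :: "'g symbol \<times> dir \<Rightarrow> 'g tape \<Rightarrow> 'g tape" where
  "act (w, d) (f, h) = (f(h := w), h + offset d)"

definition input_tape :: "bool list \<Rightarrow> 'g tape" where
  "input_tape x = (\<lambda>i. if 0 \<le> i \<and> i < int (length x) then Bit (x ! nat i) else Blank, 0)"

definition init :: "('q, 'g) ntm \<Rightarrow> bool list \<Rightarrow> ('q, 'g) config" where
  "init N x = (start N, input_tape x # replicate (tapes N - 1) (\<lambda>_. Blank, 0))"

definition step :: "('q, 'g) ntm \<Rightarrow> ('q, 'g) config \<Rightarrow> ('q, 'g) config \<Rightarrow> bool" where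
  "step N c c' \<longleftrightarrow> (\<exists>q ts q' as. c = (q, ts) \<and> (q, map read ts, q', as) \<in> trans N \<and>
     c' = (q', map2 act as ts))"

definition halted :: "('q, 'g) ntm \<Rightarrow> ('q, 'g) config \<Rightarrow> bool" where
  "halted N c \<longleftrightarrow> (\<nexists>c'. step N c c')"

text \<open>The time bound applies to all computation paths, accepting or not.\<close>

definition nptm :: "('q, 'g) ntm \<Rightarrow> bool" where
  "nptm N \<longleftrightarrow> ntm N \<and>
     (\<exists>p :: nat poly. \<forall>x n c. (step N ^^ n) (init N x) c \<longrightarrow> n \<le> poly p (length x))"

text \<open>
  An accepting path is a complete computation ending in an accepting state. Paths are sequences of
  configurations; by \<open>transition_unique\<close> below, counting these is the same as counting
  sequences of nondeterministic choices.
\<close>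

definition acc_paths :: "('q, 'g) ntm \<Rightarrow> bool list \<Rightarrow> ('q, 'g) config list set" where
  "acc_paths N x = {cs. cs \<noteq> [] \<and> hd cs = init N x \<and> successively (step N) cs \<and>
     halted N (last cs) \<and> fst (last cs) \<in> accepting N}"

definition num_acc :: "('q, 'g) ntm \<Rightarrow> bool list \<Rightarrow> nat" where
  "num_acc N x = card (acc_paths N x)"

text \<open>
  State sets and alphabets are finite, so taking both to consist of natural numbers is no
  restriction.
\<close>

definition RC :: "nat set \<Rightarrow> bool list set set" where
  "RC S = {L. \<exists>N :: (nat, nat) ntm. nptm N \<and>
     (\<forall>x. (x \<notin> L \<longrightarrow> num_acc N x = 0) \<and> (x \<in> L \<longrightarrow> num_acc N x \<in> S))}"

definition UP_le :: "nat \<Rightarrow> bool list set set" where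
  "UP_le k = {L. \<exists>N :: (nat, nat) ntm. nptm N \<and>
     (\<forall>x. (x \<notin> L \<longrightarrow> num_acc N x = 0) \<and> (x \<in> L \<longrightarrow> 1 \<le> num_acc N x \<and> num_acc N x \<le> k))}"

lemma act_inject: "act a t = act b t \<longleftrightarrow> a = b"
proof -
  obtain w d w' d' f h where [simp]: "a = (w, d)" "b = (w', d')" "t = (f, h)"
    by (metis surj_pair)
  have "f(h := w) = f(h := w') \<longleftrightarrow> w = w'"
    by (metis fun_upd_same)
  moreover have "offset d = offset d' \<longleftrightarrow> d = d'"
    by (cases d; cases d') auto
  ultimately show ?thesis by simp
qed

lemma transition_unique:
  assumes "ntm N"
    and "(q, map read ts, q1, as1) \<in> trans N" "(q, map read ts, q2, as2) \<in> trans N"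
    and "(q1, map2 act as1 ts) = (q2, map2 act as2 ts)"
  shows "q1 = q2 \<and> as1 = as2"
proof -
  have len: "length ts = tapes N" "length as1 = tapes N" "length as2 = tapes N"
    using assms(1-3) unfolding ntm_def by fastforce+
  have "as1 ! i = as2 ! i" if "i < tapes N" for i
  proof -
    have "map2 act as1 ts ! i = map2 act as2 ts ! i" using assms(4) by simp
    then show ?thesis using that len by (simp add: act_inject)
  qed
  then show ?thesis using assms(4) len by (auto intro: nth_equalityI)
qed

lemma finite_trans:
  assumes "ntm N" shows "finite (trans N)"
proof -
  let ?R = "{rs. set rs \<subseteq> alphabet N \<and> length rs = tapes N}"
  let ?A = "{as. set as \<subseteq> alphabet N \<times> {Left, Stay, Right} \<and> length as = tapes N}"
  have fin: "finite (alphabet N)" "finite (states N)"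
    using assms by (auto simp: ntm_def alphabet_def)
  have D: "d \<in> {Left, Stay, Right}" for d by (cases d) auto
  have "trans N \<subseteq> states N \<times> ?R \<times> states N \<times> ?A"
  proof
    fix t assume t: "t \<in> trans N"
    obtain q rs q' as where [simp]: "t = (q, rs, q', as)" by (metis surj_pair)
    have "q \<in> states N" "q' \<in> states N" "length rs = tapes N" "set rs \<subseteq> alphabet N"
        "length as = tapes N" "fst ` set as \<subseteq> alphabet N"
      using assms t unfolding ntm_def by fastforce+
    then show "t \<in> states N \<times> ?R \<times> states N \<times> ?A" using D by fastforce
  qed
  moreover have "finite ?R" "finite ?A"
    using fin by (auto intro!: finite_lists_length_eq)
  ultimately show ?thesis using fin by (meson finite_SigmaI finite_subset)
qed

lemma finite_step: "ntm N \<Longrightarrow> finite {c'. step N c c'}"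
proof -
  assume "ntm N"
  then have "finite ((\<lambda>(q, rs, q', as). (q', map2 act as (snd c))) ` trans N)"
    by (simp add: finite_trans)
  then show ?thesis
    by (rule finite_subset[rotated]) (force simp: step_def)
qed

text \<open>In particular \<open>num_acc\<close> is never the cardinality of an infinite set.\<close>

lemma finite_acc_paths:
  assumes "nptm N" shows "finite (acc_paths N x)"
proof -
  have N: "ntm N" using assms by (simp add: nptm_def)
  obtain p :: "nat poly" where p: "\<And>n c. (step N ^^ n) (init N x) c \<Longrightarrow> n \<le> poly p (length x)"
    using assms unfolding nptm_def by blast
  let ?P = "\<lambda>n c. {cs. length cs \<le> n \<and> cs \<noteq> [] \<and> hd cs = c \<and> successively (step N) cs}"
  have fin: "finite (?P n c)" for n c
  proof (induction n arbitrary: c)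
    case (Suc n)
    have "?P (Suc n) c \<subseteq> {[c]} \<union> (\<Union>c' \<in> {c'. step N c c'}. (#) c ` ?P n c')"
    proof
      fix cs assume cs: "cs \<in> ?P (Suc n) c"
      show "cs \<in> {[c]} \<union> (\<Union>c' \<in> {c'. step N c c'}. (#) c ` ?P n c')"
      proof (cases cs rule: remdups_adj.cases)
        case (3 a b xs)
        with cs have "step N c b" "b # xs \<in> ?P n b" "cs = c # b # xs" by auto
        then show ?thesis by blast
      qed (use cs in auto)
    qed
    then show ?case
      by (rule finite_subset) (use Suc finite_step[OF N] in auto)
  qed simp
  have rel: "(step N ^^ (length cs - 1)) (hd cs) (last cs)"
    if "cs \<noteq> []" "successively (step N) cs" for cs
    using that
  proof (induction cs rule: induct_list012)
    case (3 a b cs)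
    then have "step N a b" "(step N ^^ length cs) b (last (b # cs))" by auto
    then have "(step N ^^ Suc (length cs)) a (last (b # cs))" by (rule relpowp_Suc_I2)
    then show ?case by simp
  qed auto
  have "acc_paths N x \<subseteq> ?P (Suc (poly p (length x))) (init N x)"
  proof
    fix cs assume "cs \<in> acc_paths N x"
    then have cs: "cs \<noteq> []" "hd cs = init N x" "successively (step N) cs"
      by (simp_all add: acc_paths_def)
    then have "length cs - 1 \<le> poly p (length x)"
      using rel[OF cs(1,3)] p by metis
    then show "cs \<in> ?P (Suc (poly p (length x))) (init N x)" using cs by simp
  qed
  then show ?thesis using fin finite_subset by blast
qed

end

theory Submission
  imports Defs "HOL-Library.Countable" "HOL-Library.List_Lexorder"
begin

text \<open>
  If \<open>N\<close> has \<open>n \<le> k\<close> accepting paths on the input, there are \<open>n choose i\<close> sets of \<open>i\<close> of them. Hence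
  a machine that guesses a nonempty set of at most \<open>k\<close> accepting paths, listed in lexicographic
  order, and branches into \<open>c i\<close> accepting states for each set of size \<open>i\<close>, has
  \<open>f n = (\<Sum>i=1..k. c i * (n choose i))\<close> accepting paths. Since the last nonzero term of \<open>f n\<close> is
  \<open>c n\<close> and \<open>T\<close> is unbounded, the \<open>c i\<close> can be chosen one after the other such that
  \<open>f n \<in> T\<close> for \<open>1 \<le> n \<le> k\<close>; moreover \<open>f 0 = 0\<close>. To guess a set of size \<open>i\<close>, exactly \<open>k\<close> copies of
  \<open>N\<close> are run in lockstep, the first \<open>i\<close> with strictly increasing choices and the others all
  with the same choices as the \<open>i\<close>-th.
\<close>

section \<open>Counting accepting paths from a configuration\<close>

text \<open>All that a transition can see of a configuration. Which transitions are enabled depends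
  on nothing else, so the rules of the product machine can be indexed by views.\<close>

definition view :: "('q, 'g) config \<Rightarrow> 'q \<times> 'g symbol list" where
  "view c = (fst c, map read (snd c))"

definition enabled :: "('q, 'g) ntm \<Rightarrow> 'q \<times> 'g symbol list \<Rightarrow> ('q, 'g) transition set" where
  "enabled N v = {t \<in> trans N. (fst t, fst (snd t)) = v}"

definition exec :: "('q, 'g) transition \<Rightarrow> ('q, 'g) config \<Rightarrow> ('q, 'g) config" where
  "exec t c = (fst (snd (snd t)), map2 act (snd (snd (snd t))) (snd c))"

lemma step_iff: "step N c c' \<longleftrightarrow> (\<exists>t \<in> enabled N (view c). c' = exec t c)"
proof -
  obtain q ts where c: "c = (q, ts)" by (cases c)
  show ?thesis unfolding c step_def enabled_def view_def exec_def by force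
qed

lemma halted_iff: "halted N c \<longleftrightarrow> enabled N (view c) = {}"
  unfolding halted_def step_iff by blast

text \<open>By \<open>transition_unique\<close>, different choices lead to different successors.
  This lets paths, which are lists of configurations, be counted by summing over
  transitions.\<close>

lemma inj_on_exec:
  assumes "ntm N" shows "inj_on (\<lambda>t. exec t c) (enabled N (view c))"
proof (rule inj_onI)
  fix s t assume s: "s \<in> enabled N (view c)" and t: "t \<in> enabled N (view c)"
    and eq: "exec s c = exec t c"
  obtain q ts where c: "c = (q, ts)" by (cases c)
  obtain q1 rs1 p1 as1 where s': "s = (q1, rs1, p1, as1)" by (metis surj_pair)
  obtain q2 rs2 p2 as2 where t': "t = (q2, rs2, p2, as2)" by (metis surj_pair)
  show "s = t"
    using transition_unique[OF assms, of q ts p1 as1 p2 as2] s t eq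
    unfolding c s' t' by (auto simp: enabled_def view_def exec_def)
qed

lemma finite_enabled: "ntm N \<Longrightarrow> finite (enabled N v)"
  using finite_trans[of N] by (simp add: enabled_def)

text \<open>Generalises \<open>acc_paths\<close> to an arbitrary first configuration, so that paths
  can be counted by recursion along the computation.\<close>

definition acc_from :: "('q, 'g) ntm \<Rightarrow> ('q, 'g) config \<Rightarrow> ('q, 'g) config list set" where
  "acc_from N c = {cs. cs \<noteq> [] \<and> hd cs = c \<and> successively (step N) cs \<and>
     halted N (last cs) \<and> fst (last cs) \<in> accepting N}"

lemma num_acc_eq: "num_acc N x = card (acc_from N (init N x))"
  by (simp add: num_acc_def acc_paths_def acc_from_def)

lemma acc_from_halted:
  assumes "enabled N (view c) = {}"
  shows "acc_from N c = (if fst c \<in> accepting N then {[c]} else {})"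
proof -
  have h: "halted N c" using assms by (simp add: halted_iff)
  have "cs = [c]" if "cs \<in> acc_from N c" for cs
  proof (cases cs rule: remdups_adj.cases)
    case (3 a b xs)
    have "hd cs = c" "successively (step N) cs" using that by (simp_all only: acc_from_def mem_Collect_eq)
    then have "step N c b" using 3 by simp
    then show ?thesis using h halted_def by blast
  qed (use that in \<open>auto simp: acc_from_def\<close>)
  moreover have "[c] \<in> acc_from N c \<longleftrightarrow> fst c \<in> accepting N"
    using h by (simp add: acc_from_def)
  ultimately show ?thesis by auto
qed

lemma acc_from_step:
  assumes "enabled N (view c) \<noteq> {}"
  shows "acc_from N c = (\<Union>t \<in> enabled N (view c). (#) c ` acc_from N (exec t c))"
proof (intro equalityI subsetI)
  fix cs assume cs: "cs \<in> acc_from N c"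
  show "cs \<in> (\<Union>t \<in> enabled N (view c). (#) c ` acc_from N (exec t c))"
  proof (cases cs rule: remdups_adj.cases)
    case (2 a)
    then show ?thesis using cs assms by (auto simp: acc_from_def halted_iff)
  next
    case (3 a b xs)
    then have "step N c b" "b # xs \<in> acc_from N b" "cs = c # b # xs"
      using cs by (auto simp: acc_from_def)
    then show ?thesis by (auto simp: step_iff)
  qed (use cs in \<open>auto simp: acc_from_def\<close>)
next
  fix cs assume "cs \<in> (\<Union>t \<in> enabled N (view c). (#) c ` acc_from N (exec t c))"
  then obtain t ds where "t \<in> enabled N (view c)" "ds \<in> acc_from N (exec t c)" "cs = c # ds"
    by blast
  then show "cs \<in> acc_from N c"
    by (auto simp: acc_from_def step_iff successively_Cons)
qed

lemma acc_from_step_card: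
  assumes "ntm N" and "enabled N (view c) \<noteq> {}"
    and "\<And>t. t \<in> enabled N (view c) \<Longrightarrow> finite (acc_from N (exec t c))"
  shows "finite (acc_from N c)"
    and "card (acc_from N c) = (\<Sum>t \<in> enabled N (view c). card (acc_from N (exec t c)))"
proof -
  note fin = finite_enabled[OF assms(1)]
  show "finite (acc_from N c)"
    unfolding acc_from_step[OF assms(2)] using fin assms(3) by blast
  have disj: "((#) c ` acc_from N (exec s c)) \<inter> ((#) c ` acc_from N (exec t c)) = {}"
    if "s \<in> enabled N (view c)" "t \<in> enabled N (view c)" "s \<noteq> t" for s t
  proof -
    \<comment> \<open>Paths through different successors already differ in their second
      entry.\<close>
    have "exec s c \<noteq> exec t c" using inj_on_exec[OF assms(1), of c] that by (auto dest: inj_onD)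
    then show ?thesis by (auto simp: acc_from_def)
  qed
  show "card (acc_from N c) = (\<Sum>t \<in> enabled N (view c). card (acc_from N (exec t c)))"
    unfolding acc_from_step[OF assms(2)]
    by (subst card_UN_disjoint) (use fin assms(3) disj in \<open>auto simp: card_image\<close>)
qed

definition runtime_le :: "('q, 'g) ntm \<Rightarrow> ('q, 'g) config \<Rightarrow> nat \<Rightarrow> bool" where
  "runtime_le N c b \<longleftrightarrow> (\<forall>n c'. (step N ^^ n) c c' \<longrightarrow> n \<le> b)"

lemma runtime_le_0: "runtime_le N c 0 \<longleftrightarrow> enabled N (view c) = {}"
proof
  assume r: "runtime_le N c 0"
  show "enabled N (view c) = {}"
  proof (rule ccontr)
    assume "enabled N (view c) \<noteq> {}"
    then obtain c' where "step N c c'" unfolding step_iff by blast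
    then have "(step N ^^ Suc 0) c c'" by (rule relpowp_Suc_I2[OF _ relpowp_0_I])
    then show False using r unfolding runtime_le_def by fastforce
  qed
next
  assume e: "enabled N (view c) = {}"
  have "n = 0" if "(step N ^^ n) c c'" for n c'
  proof (cases n)
    case (Suc m)
    then show ?thesis using that e relpowp_Suc_D2[of m "step N" c c'] unfolding step_iff by blast
  qed
  then show "runtime_le N c 0" unfolding runtime_le_def by blast
qed

lemma runtime_le_Suc:
  "runtime_le N c (Suc b) \<longleftrightarrow> (\<forall>t \<in> enabled N (view c). runtime_le N (exec t c) b)"
proof
  assume r: "runtime_le N c (Suc b)"
  show "\<forall>t \<in> enabled N (view c). runtime_le N (exec t c) b"
    unfolding runtime_le_def
  proof (intro ballI allI impI)
    fix t n c' assume "t \<in> enabled N (view c)" "(step N ^^ n) (exec t c) c'"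
    then have "(step N ^^ Suc n) c c'" by (meson step_iff relpowp_Suc_I2)
    then show "n \<le> b" using r unfolding runtime_le_def by fastforce
  qed
next
  assume e: "\<forall>t \<in> enabled N (view c). runtime_le N (exec t c) b"
  show "runtime_le N c (Suc b)" unfolding runtime_le_def
  proof (intro allI impI)
    fix n c' assume n: "(step N ^^ n) c c'"
    show "n \<le> Suc b"
    proof (cases n)
      case (Suc m)
      then obtain d where "step N c d" "(step N ^^ m) d c'" using n relpowp_Suc_D2 by metis
      moreover have "runtime_le N d b" using e \<open>step N c d\<close> by (auto simp: step_iff)
      ultimately have "m \<le> b" unfolding runtime_le_def by blast
      then show ?thesis using Suc by simp
    qed simp
  qed
qed

lemma nptm_iff: "nptm N \<longleftrightarrow> ntm N \<and> (\<exists>p. \<forall>x. runtime_le N (init N x) (poly p (length x)))"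
  unfolding nptm_def runtime_le_def by blast

text \<open>Time bound and number of paths travel through the same inductions. Finiteness is
  included because \<open>card\<close> of an infinite set is 0.\<close>

definition counts :: "('q, 'g) ntm \<Rightarrow> ('q, 'g) config \<Rightarrow> nat \<Rightarrow> nat \<Rightarrow> bool" where
  "counts N c b n \<longleftrightarrow> runtime_le N c b \<and> finite (acc_from N c) \<and> card (acc_from N c) = n"

lemma counts_halted:
  assumes "enabled N (view c) = {}"
  shows "counts N c b (of_bool (fst c \<in> accepting N))"
proof -
  have "runtime_le N c b" using assms by (cases b) (auto simp: runtime_le_0 runtime_le_Suc)
  then show ?thesis by (simp add: counts_def acc_from_halted[OF assms])
qed

text \<open>The state is required to be non-accepting so that the formula also covers a halted
  configuration: the sum is then empty, and 0 must be the right count.\<close>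

lemma counts_step:
  assumes "ntm N" "fst c \<notin> accepting N"
    and "\<And>t. t \<in> enabled N (view c) \<Longrightarrow> counts N (exec t c) b (f t)"
  shows "counts N c (Suc b) (\<Sum>t \<in> enabled N (view c). f t)"
proof (cases "enabled N (view c) = {}")
  case True
  then show ?thesis using counts_halted[OF True, of "Suc b"] assms(2) by simp
next
  case False
  then show ?thesis
    using acc_from_step_card[OF assms(1) False] assms(3) by (simp add: counts_def runtime_le_Suc)
qed

lemma counts_det:
  assumes "ntm N" "fst c \<notin> accepting N" "enabled N (view c) = {t}" "counts N (exec t c) b n"
  shows "counts N c (Suc b) n"
  using counts_step[of N c b "\<lambda>_. n"] assms by simp

section \<open>Padded choice sequences\<close>

instance dir :: countable by countable_datatype
instance symbol :: (countable) countable by countable_datatype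

text \<open>The idle move \<open>None\<close> is offered exactly when \<open>N\<close> has halted.
  Thus there is always a move, and a halted copy can wait for the others.\<close>

definition moves :: "('q, 'g) ntm \<Rightarrow> 'q \<times> 'g symbol list \<Rightarrow> ('q, 'g) transition option set" where
  "moves N v = (if enabled N v = {} then {None} else Some ` enabled N v)"

definition target :: "('q, 'g) transition option \<Rightarrow> 'q \<times> 'g symbol list \<Rightarrow> 'q" where
  "target m v = (case m of None \<Rightarrow> fst v | Some t \<Rightarrow> fst (snd (snd t)))"

text \<open>One product transition acts on all tapes, so idling is spelled out as rewriting the
  symbols read without moving the heads.\<close>

definition acts :: "('q, 'g) transition option \<Rightarrow> 'q \<times> 'g symbol list \<Rightarrow> ('g symbol \<times> dir) list" where
  "acts m v = (case m of None \<Rightarrow> map (\<lambda>s. (s, Stay)) (snd v) | Some t \<Rightarrow> snd (snd (snd t)))"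

definition perform :: "('q, 'g) transition option \<Rightarrow> ('q, 'g) config \<Rightarrow> ('q, 'g) config" where
  "perform m c = (target m (view c), map2 act (acts m (view c)) (snd c))"

lemma perform_Some: "perform (Some t) c = exec t c"
  by (simp add: perform_def exec_def target_def acts_def)

lemma map2_act_stay: "map2 act (map (\<lambda>t. (read t, Stay)) ts) ts = ts"
  by (induction ts) auto

lemma perform_None: "perform None c = c"
  by (simp add: perform_def target_def acts_def view_def map2_act_stay comp_def)

lemma finite_moves: "ntm N \<Longrightarrow> finite (moves N v)"
  by (simp add: moves_def finite_enabled)

lemma runtime_le_perform:
  assumes "runtime_le N c (Suc b)" "m \<in> moves N (view c)"
  shows "runtime_le N (perform m c) b"
proof (cases "enabled N (view c) = {}")
  case True
  then have "m = None" using assms(2) by (simp add: moves_def)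
  moreover have "runtime_le N c b" using counts_halted[OF True] by (simp add: counts_def)
  ultimately show ?thesis by (simp add: perform_None)
next
  case False
  then show ?thesis using assms by (auto simp: moves_def runtime_le_Suc perform_Some)
qed

text \<open>
  Padding with the idle move \<open>None\<close> makes all sequences equally long, so that several runs can be
  compared lexicographically while they are executed in lockstep.
\<close>

fun codes :: "('q :: countable, 'g :: countable) ntm \<Rightarrow> nat \<Rightarrow> ('q, 'g) config \<Rightarrow> nat list set" where
  "codes N 0 c = (if enabled N (view c) = {} \<and> fst c \<in> accepting N then {[]} else {})"
| "codes N (Suc b) c = (\<Union>m \<in> moves N (view c). (#) (to_nat m) ` codes N b (perform m c))"

lemma codes_halted:
  fixes N :: "('q :: countable, 'g :: countable) ntm"
  assumes "enabled N (view c) = {}"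
  shows "codes N b c = (if fst c \<in> accepting N then {replicate b (to_nat (None :: ('q, 'g) transition option))}
     else {})"
  using assms by (induction b) (auto simp: moves_def perform_None)

text \<open>Both sets obey the same recursion. They split disjointly over the enabled transitions,
  told apart by the second configuration on one side and by the first code on the other; from a
  halted configuration, only idling remains.\<close>

lemma counts_codes:
  assumes "ntm N" "runtime_le N c b"
  shows "finite (codes N b c) \<and> finite (acc_from N c) \<and> card (codes N b c) = card (acc_from N c)"
  using assms(2)
proof (induction b arbitrary: c)
  case 0
  then show ?case by (auto simp: runtime_le_0 acc_from_halted)
next
  case (Suc b)
  show ?case
  proof (cases "enabled N (view c) = {}")
    case True
    then show ?thesis by (simp add: codes_halted acc_from_halted del: codes.simps)
  next
    case False
    let ?E = "enabled N (view c)"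
    have IH: "finite (codes N b (exec t c)) \<and> finite (acc_from N (exec t c)) \<and>
        card (codes N b (exec t c)) = card (acc_from N (exec t c))" if "t \<in> ?E" for t
      using Suc that by (simp add: runtime_le_Suc)
    have eq: "codes N (Suc b) c = (\<Union>t \<in> ?E. (#) (to_nat (Some t)) ` codes N b (exec t c))"
      using False by (simp add: moves_def perform_Some)
    have "card (codes N (Suc b) c) = (\<Sum>t \<in> ?E. card (codes N b (exec t c)))"
      unfolding eq by (subst card_UN_disjoint)
        (use finite_enabled[OF assms(1)] IH in \<open>auto simp: card_image\<close>)
    moreover have "finite (codes N (Suc b) c)"
      unfolding eq using finite_enabled[OF assms(1)] IH by blast
    ultimately show ?thesis
      using acc_from_step_card[OF assms(1) False] IH by simp
  qed
qed

lemma finite_codes: "ntm N \<Longrightarrow> finite (codes N b c)"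
  by (induction b arbitrary: c) (auto simp: finite_moves)

section \<open>Ordered tuples of paths\<close>

text \<open>A set mark \<open>ms ! j\<close> records that an earlier position has already decided
  the comparison of entries \<open>j\<close> and \<open>Suc j\<close>. The definition is used at two
  types: for the codes chosen in one step, and for whole code lists, which are compared
  lexicographically.\<close>

definition ordered :: "bool list \<Rightarrow> 'a :: linorder list \<Rightarrow> bool" where
  "ordered ms ps \<longleftrightarrow> (\<forall>j < length ms. ms ! j \<or> ps ! j \<le> ps ! Suc j)"

definition marks :: "bool list \<Rightarrow> 'a list \<Rightarrow> bool list" where
  "marks ms ps = map (\<lambda>j. ms ! j \<or> ps ! j \<noteq> ps ! Suc j) [0..<length ms]"

text \<open>The number of accepting paths that the product machine gets from the tuple
  \<open>ps\<close> of runs when it starts with the marks \<open>ms\<close>.\<close>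

definition weight :: "(bool list \<Rightarrow> nat) \<Rightarrow> bool list \<Rightarrow> 'a :: linorder list \<Rightarrow> nat" where
  "weight wt ms ps = (if ordered ms ps then wt (marks ms ps) else 0)"

lemma length_marks [simp]: "length (marks ms ps) = length ms"
  by (simp add: marks_def)

text \<open>In a lexicographic comparison the heads decide unless they are equal, in which case the
  tails do. So the weight can be evaluated one letter at a time with only the marks as memory, which
  is what the lockstep simulation does.\<close>

lemma weight_Cons:
  assumes "length as = Suc (length ms)" "length ps = Suc (length ms)"
  shows "weight wt ms (map2 (#) as ps) = (if ordered ms as then weight wt (marks ms as) ps else 0)"
proof -
  have nth: "map2 (#) as ps ! j = as ! j # ps ! j" if "j < Suc (length ms)" for j
    using assms that by simp
  have "(ms ! j \<or> map2 (#) as ps ! j \<le> map2 (#) as ps ! Suc j) \<longleftrightarrow>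
      (ms ! j \<or> as ! j \<le> as ! Suc j) \<and> (marks ms as ! j \<or> ps ! j \<le> ps ! Suc j)"
    if "j < length ms" for j
    using nth[of j] nth[of "Suc j"] that by (auto simp: marks_def)
  then have "ordered ms (map2 (#) as ps) \<longleftrightarrow> ordered ms as \<and> ordered (marks ms as) ps"
    unfolding ordered_def length_marks by blast
  moreover have "marks ms (map2 (#) as ps) = marks (marks ms as) ps"
    unfolding marks_def using nth by (intro nth_equalityI) auto
  ultimately show ?thesis by (simp add: weight_def)
qed

text \<open>Applies once all copies have halted: their remaining codes are the same idle lists, so
  the marks are final.\<close>

lemma weight_replicate: "weight wt ms (replicate (Suc (length ms)) p) = wt ms"
proof -
  have nth: "replicate (Suc (length ms)) p ! j = p" if "j < Suc (length ms)" for j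
    using that by (rule nth_replicate)
  have "marks ms (replicate (Suc (length ms)) p) = map ((!) ms) [0..<length ms]"
    unfolding marks_def using nth by (intro map_cong) auto
  moreover have "ordered ms (replicate (Suc (length ms)) p)"
    unfolding ordered_def using nth by auto
  ultimately show ?thesis by (simp add: weight_def map_nth)
qed

lemma finite_list_all2:
  assumes "\<And>c. c \<in> set cs \<Longrightarrow> finite (A c)"
  shows "finite {ps. list_all2 (\<lambda>p c. p \<in> A c) ps cs}"
  using assms
proof (induction cs)
  case (Cons c cs)
  have "{ps. list_all2 (\<lambda>p c. p \<in> A c) ps (c # cs)}
      = (\<lambda>(p, ps). p # ps) ` (A c \<times> {ps. list_all2 (\<lambda>p c. p \<in> A c) ps cs})"
    by (auto simp: list_all2_Cons2)
  then show ?case using Cons by simp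
qed simp

lemma list_all2_ex: "list_all2 P xs ys \<Longrightarrow> x \<in> set xs \<Longrightarrow> \<exists>y \<in> set ys. P x y"
  by (fastforce simp: list_all2_conv_all_nth in_set_conv_nth)

text \<open>Cutting off the first letter of every list is a bijection from tuples of code lists to
  pairs of a joint first move and a tuple of remainders.\<close>

lemma sum_tuples_Suc:
  fixes N :: "('q :: countable, 'g :: countable) ntm" and f :: "nat list list \<Rightarrow> nat"
  assumes "ntm N"
  shows "(\<Sum>ps | list_all2 (\<lambda>p c. p \<in> codes N (Suc b) c) ps cs. f ps) =
    (\<Sum>mvs | list_all2 (\<lambda>m c. m \<in> moves N (view c)) mvs cs.
      \<Sum>ps | list_all2 (\<lambda>p c. p \<in> codes N b c) ps (map2 perform mvs cs).
        f (map2 (#) (map to_nat mvs) ps))"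
proof -
  let ?M = "{mvs. list_all2 (\<lambda>m c. m \<in> moves N (view c)) mvs cs}"
  let ?P = "\<lambda>mvs. {ps. list_all2 (\<lambda>p c. p \<in> codes N b c) ps (map2 perform mvs cs)}"
  have "(\<Sum>mvs \<in> ?M. \<Sum>ps \<in> ?P mvs. f (map2 (#) (map to_nat mvs) ps))
      = (\<Sum>(mvs, ps) \<in> Sigma ?M ?P. f (map2 (#) (map to_nat mvs) ps))"
    by (rule sum.Sigma) (auto intro!: finite_list_all2 finite_codes finite_moves assms)
  also have "\<dots> = (\<Sum>ps | list_all2 (\<lambda>p c. p \<in> codes N (Suc b) c) ps cs. f ps)"
  proof (rule sum.reindex_bij_witness[where
        i = "\<lambda>ps. (map (from_nat \<circ> hd) ps, map tl ps)" and
        j = "\<lambda>(mvs, ps). map2 (#) (map to_nat mvs) ps"], goal_cases)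
    case (1 a)
    then obtain mvs ps where a: "a = (mvs, ps)" "length mvs = length cs" "length ps = length cs"
      by (auto simp: list_all2_conv_all_nth)
    then show ?case by (auto intro!: nth_equalityI)
  next
    case (2 a)
    then show ?case by (fastforce simp: list_all2_conv_all_nth)
  next
    case (3 ps)
    then show ?case by (fastforce simp: list_all2_conv_all_nth intro!: nth_equalityI)
  next
    case (4 ps)
    then show ?case by (fastforce simp: list_all2_conv_all_nth)
  next
    case (5 a)
    then show ?case by auto
  qed
  finally show ?thesis by simp
qed

section \<open>The product machine\<close>

text \<open>The phases: copying the input to the right, returning to its left end, simulating with
  the states of all copies and the marks, and accepting. Countability turns these values into
  natural numbers via \<open>to_nat\<close>.\<close>

datatype ctrl = Fwd | Back | Sim "nat list" "bool list" | Done nat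

instance ctrl :: countable by countable_datatype

text \<open>The group of tapes of one copy of \<open>N\<close>: \<open>a\<close> belongs to its
  input tape, \<open>b\<close> to each of its work tapes.\<close>

definition grp :: "('q, 'g) ntm \<Rightarrow> 'a \<Rightarrow> 'a \<Rightarrow> 'a list" where
  "grp N a b = a # replicate (tapes N - 1) b"

definition fwd_trans :: "(nat, nat) ntm \<Rightarrow> nat \<Rightarrow> bool \<Rightarrow> (nat, nat) transition" where
  "fwd_trans N K b = (to_nat Fwd, concat (grp N (Bit b) Blank # replicate K (grp N Blank Blank)),
     to_nat Fwd, concat (replicate (Suc K) (grp N (Bit b, Right) (Blank, Stay))))"

definition input_trans ::
    "(nat, nat) ntm \<Rightarrow> nat \<Rightarrow> ctrl \<Rightarrow> nat symbol \<Rightarrow> ctrl \<Rightarrow> dir \<Rightarrow> (nat, nat) transition" where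
  "input_trans N K s r s' d = (to_nat s, concat (replicate (Suc K) (grp N r Blank)),
     to_nat s', concat (replicate (Suc K) (grp N (r, d) (Blank, Stay))))"

abbreviation sim_start :: "(nat, nat) ntm \<Rightarrow> nat \<Rightarrow> ctrl" where
  "sim_start N K \<equiv> Sim (replicate (Suc K) (start N)) (replicate K False)"

definition sim_trans :: "(nat \<times> nat symbol list) list \<Rightarrow> bool list \<Rightarrow>
    (nat, nat) transition option list \<Rightarrow> (nat, nat) transition" where
  "sim_trans vs ms mvs = (to_nat (Sim (map fst vs) ms), concat (map snd vs),
     to_nat (Sim (map2 target mvs vs) (marks ms (map to_nat mvs))), concat (map2 acts mvs vs))"

definition done_trans ::
    "(nat \<times> nat symbol list) list \<Rightarrow> bool list \<Rightarrow> nat \<Rightarrow> (nat, nat) transition" where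
  "done_trans vs ms i = (to_nat (Sim (map fst vs) ms), concat (map snd vs),
     to_nat (Done i), concat (map (acts None) vs))"

definition views :: "('q, 'g) ntm \<Rightarrow> ('q \<times> 'g symbol list) set" where
  "views N = states N \<times> {rs. set rs \<subseteq> alphabet N \<and> length rs = tapes N}"

definition copy_rules :: "(nat, nat) ntm \<Rightarrow> nat \<Rightarrow> (nat, nat) transition set" where
  "copy_rules N K = range (fwd_trans N K) \<union> {input_trans N K Fwd Blank Back Left} \<union>
     range (\<lambda>b. input_trans N K Back (Bit b) Back Left) \<union>
     {input_trans N K Back Blank (sim_start N K) Right}"

text \<open>Some copy has to make a real move. If all copies could idle together, the machine would
  loop after they have halted and violate every time bound.\<close>

definition sim_rules :: "(nat, nat) ntm \<Rightarrow> nat \<Rightarrow> (nat, nat) transition set" where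
  "sim_rules N K = {sim_trans vs ms mvs | vs ms mvs.
     set vs \<subseteq> views N \<and> length vs = Suc K \<and> length ms = K \<and>
     list_all2 (\<lambda>m v. m \<in> moves N v) mvs vs \<and> (\<exists>m \<in> set mvs. m \<noteq> None) \<and>
     ordered ms (map to_nat mvs)}"

definition done_rules ::
    "(nat, nat) ntm \<Rightarrow> nat \<Rightarrow> (bool list \<Rightarrow> nat) \<Rightarrow> (nat, nat) transition set" where
  "done_rules N K wt = {done_trans vs ms i | vs ms i.
     set vs \<subseteq> views N \<and> length vs = Suc K \<and> length ms = K \<and>
     (\<forall>v \<in> set vs. enabled N v = {} \<and> fst v \<in> accepting N) \<and> i < wt ms}"

text \<open>
  The machine copies its input to the first tapes of \<open>K\<close> further groups of tapes and then runs
  \<open>K + 1\<close> copies of \<open>N\<close> in lockstep. The \<open>j\<close>-th mark records whether the choices of copies \<open>j\<close> and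
  \<open>j + 1\<close> have differed so far; the first difference has to be an increase. The final marks \<open>ms\<close>
  determine the number \<open>wt ms\<close> of accepting states that can be chosen in the last step.
\<close>

definition prod_ntm :: "(nat, nat) ntm \<Rightarrow> nat \<Rightarrow> (bool list \<Rightarrow> nat) \<Rightarrow> (nat, nat) ntm" where
  "prod_ntm N K wt = \<lparr>
     tapes = Suc K * tapes N,
     states = to_nat ` ({Fwd, Back} \<union>
       {Sim qs ms | qs ms. set qs \<subseteq> states N \<and> length qs = Suc K \<and> length ms = K} \<union>
       {Done i | i. \<exists>ms. length ms = K \<and> i < wt ms}),
     aux = aux N,
     start = to_nat Fwd,
     accepting = to_nat ` {Done i | i. \<exists>ms. length ms = K \<and> i < wt ms},
     trans = copy_rules N K \<union> sim_rules N K \<union> done_rules N K wt\<rparr>"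

section \<open>Well-formedness of the product machine\<close>

lemma length_concat_const:
  "(\<And>xs. xs \<in> set xss \<Longrightarrow> length xs = n) \<Longrightarrow> length (concat xss) = length xss * n"
  by (induction xss) auto

text \<open>Recovers the individual groups of tapes from the flat lists of symbols or
  actions.\<close>

lemma concat_inject:
  assumes "\<And>x y. (x, y) \<in> set (zip xs ys) \<Longrightarrow> length x = length y"
    and "length xs = length ys" "concat xs = concat ys"
  shows "xs = ys"
proof -
  have "\<forall>(x, y) \<in> set (zip xs ys). length x = length y"
    using assms(1) by (intro ballI case_prodI2) simp
  then show ?thesis using concat_eq_concat_iff[of xs ys] assms(2,3) by simp
qed

lemma map2_concat:
  "list_all2 (\<lambda>xs ys. length xs = length ys) xss yss \<Longrightarrow>
    map2 f (concat xss) (concat yss) = concat (map2 (map2 f) xss yss)"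
  by (induction rule: list_all2_induct) auto

lemma length_grp: "ntm N \<Longrightarrow> length (grp N a b) = tapes N"
  by (simp add: grp_def ntm_def)

lemma set_grp: "set (grp N a b) \<subseteq> {a, b}"
  by (auto simp: grp_def)

lemma moves_valid:
  assumes "ntm N" "v \<in> views N" "m \<in> moves N v"
  shows "target m v \<in> states N" "length (acts m v) = tapes N" "fst ` set (acts m v) \<subseteq> alphabet N"
proof -
  have "target m v \<in> states N \<and> length (acts m v) = tapes N \<and> fst ` set (acts m v) \<subseteq> alphabet N"
  proof (cases m)
    case None
    then show ?thesis using assms(2) by (auto simp: views_def target_def acts_def)
  next
    case (Some t)
    then have "t \<in> trans N" using assms(3) by (auto simp: moves_def enabled_def split: if_splits)
    then show ?thesis using assms(1) Some unfolding ntm_def target_def acts_def by fastforce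
  qed
  then show "target m v \<in> states N" "length (acts m v) = tapes N"
    "fst ` set (acts m v) \<subseteq> alphabet N" by auto
qed

text \<open>The view fixes the source state and the symbols read, so target and actions determine
  the transition; \<open>None\<close> never competes with a transition.\<close>

lemma moves_inject:
  assumes "m \<in> moves N v" "m' \<in> moves N v" "target m v = target m' v" "acts m v = acts m' v"
  shows "m = m'"
  using assms by (auto simp: moves_def enabled_def target_def acts_def split: if_splits)

lemma alphabet_prod [simp]: "alphabet (prod_ntm N K wt) = alphabet N"
  by (simp add: alphabet_def prod_ntm_def)

lemma symbols_alphabet [simp]: "Blank \<in> alphabet N" "Bit b \<in> alphabet N"
  by (cases b; simp add: alphabet_def)+

text \<open>The uniform bound \<open>W\<close> serves to make the set of \<open>Done\<close> states
  finite.\<close>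

lemma ntm_prod:
  assumes N: "ntm N" and wt: "\<And>ms. wt ms \<le> W"
  shows "ntm (prod_ntm N K wt)"
proof -
  let ?P = "prod_ntm N K wt"
  have fin: "finite (states ?P)"
  proof -
    have "{Sim qs ms | qs ms. set qs \<subseteq> states N \<and> length qs = Suc K \<and> length ms = K} =
      (\<lambda>(qs, ms). Sim qs ms) ` ({qs. set qs \<subseteq> states N \<and> length qs = Suc K} \<times>
        {ms. set ms \<subseteq> UNIV \<and> length ms = K})" by auto
    moreover have "finite {qs. set qs \<subseteq> states N \<and> length qs = Suc K}"
      using N by (intro finite_lists_length_eq) (simp add: ntm_def)
    moreover have "finite {ms :: bool list. set ms \<subseteq> UNIV \<and> length ms = K}"
      by (intro finite_lists_length_eq) simp
    moreover have "{Done i | i. \<exists>ms. length ms = K \<and> i < wt ms} \<subseteq> Done ` {..<W}"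
      using wt by (auto intro: less_le_trans)
    ultimately show ?thesis
      unfolding prod_ntm_def by (auto intro: finite_subset)
  qed
  have len: "length (concat (replicate (Suc K) (grp N a b))) = Suc K * tapes N" for a b :: 'a
    by (subst length_concat_const[where n = "tapes N"]) (use length_grp[OF N] in auto)
  have set: "set (concat (replicate (Suc K) (grp N a b))) \<subseteq> {a, b}" for a b :: 'a
    using set_grp[of N a b] by (auto simp del: replicate_Suc)
  \<comment> \<open>The condition that \<open>ntm\<close> imposes on a single transition; it is now
    checked for each kind of rule.\<close>
  define ok :: "(nat, nat) transition \<Rightarrow> bool" where "ok = (\<lambda>(q, rs, q', as). q \<in> states ?P \<and> q' \<in> states ?P \<and>
    length rs = tapes ?P \<and> set rs \<subseteq> alphabet ?P \<and>
    length as = tapes ?P \<and> fst ` set as \<subseteq> alphabet ?P)"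
  have ctrl: "to_nat Fwd \<in> states ?P" "to_nat Back \<in> states ?P"
    "to_nat (sim_start N K) \<in> states ?P"
  proof -
    have "set (replicate (Suc K) (start N)) \<subseteq> states N" using N by (simp add: ntm_def set_replicate_conv_if)
    then show "to_nat (sim_start N K) \<in> states ?P"
      unfolding prod_ntm_def ntm.simps by (intro imageI UnI1 UnI2) fastforce
  qed (auto simp: prod_ntm_def)
  have tapes: "tapes ?P = Suc K * tapes N" by (simp add: prod_ntm_def)
  have "ok (fwd_trans N K b)" for b
  proof -
    have "set (concat (grp N (Bit b) Blank # replicate K (grp N Blank Blank))) \<subseteq> {Bit b, Blank}"
      using set_grp[of N] by fastforce
    moreover have "length (concat (grp N (Bit b) Blank # replicate K (grp N Blank Blank))) = Suc K * tapes N"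
      by (subst length_concat_const[where n = "tapes N"]) (use length_grp[OF N] in auto)
    ultimately show ?thesis using ctrl set[of "(Bit b, Right)" "(Blank, Stay)"]
      unfolding ok_def fwd_trans_def prod.case tapes alphabet_prod len
      by (auto simp del: concat.simps replicate_Suc)
  qed
  moreover have input: "ok (input_trans N K s r s' d)"
    if "to_nat s \<in> states ?P" "to_nat s' \<in> states ?P" "r \<in> alphabet N" for s r s' d
    using that set[of r Blank] set[of "(r, d)" "(Blank, Stay)"]
    unfolding ok_def input_trans_def prod.case tapes alphabet_prod len
    by (auto simp del: concat.simps replicate_Suc)
  moreover have "ok (sim_trans vs ms mvs)"
    if vs: "set vs \<subseteq> views N" "length vs = Suc K" "length ms = K"
      and mvs: "list_all2 (\<lambda>m v. m \<in> moves N v) mvs vs" for vs ms mvs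
  proof -
    have m: "m \<in> moves N v \<and> v \<in> views N" if "(m, v) \<in> set (zip mvs vs)" for m v
      using that vs mvs by (auto simp: list_all2_iff dest: set_zip_rightD)
    have "length mvs = Suc K" using mvs vs by (simp add: list_all2_lengthD)
    then have "length (concat (map2 acts mvs vs)) = Suc K * tapes N"
      using vs m moves_valid(2)[OF N] by (subst length_concat_const[where n = "tapes N"]) auto
    moreover have "length (concat (map snd vs)) = Suc K * tapes N"
      using vs by (subst length_concat_const[where n = "tapes N"]) (auto simp: views_def)
    moreover have "set (concat (map snd vs)) \<subseteq> alphabet N" "set (map fst vs) \<subseteq> states N"
      using vs by (fastforce simp: views_def)+
    moreover have "fst ` set (concat (map2 acts mvs vs)) \<subseteq> alphabet N"
      using m moves_valid(3)[OF N] by fastforce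
    moreover have "set (map2 target mvs vs) \<subseteq> states N"
      using m moves_valid(1)[OF N] by fastforce
    ultimately show ?thesis using \<open>length mvs = Suc K\<close> vs
      unfolding ok_def sim_trans_def prod.case tapes alphabet_prod
      by (simp add: prod_ntm_def)
  qed
  moreover have "ok (done_trans vs ms i)"
    if vs: "set vs \<subseteq> views N" "length vs = Suc K" "length ms = K" "i < wt ms" for vs ms i
  proof -
    have "length (concat (map snd vs)) = Suc K * tapes N"
      using vs by (subst length_concat_const[where n = "tapes N"]) (auto simp: views_def)
    moreover have "length (concat (map (acts None) vs)) = Suc K * tapes N"
      using vs by (subst length_concat_const[where n = "tapes N"]) (auto simp: views_def acts_def)
    moreover have "set (concat (map snd vs)) \<subseteq> alphabet N" "set (map fst vs) \<subseteq> states N"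
      "fst ` set (concat (map (acts None) vs)) \<subseteq> alphabet N"
      using vs by (fastforce simp: views_def acts_def)+
    ultimately show ?thesis using vs
      unfolding ok_def done_trans_def prod.case tapes alphabet_prod
      by (auto simp: prod_ntm_def)
  qed
  moreover have "ok (input_trans N K Fwd Blank Back Left)"
    "ok (input_trans N K Back (Bit b) Back Left)"
    "ok (input_trans N K Back Blank (sim_start N K) Right)" for b
    using ctrl by (simp_all add: input)
  ultimately have "ok t" if "t \<in> trans ?P" for t
    using that unfolding prod_ntm_def ntm.simps copy_rules_def sim_rules_def done_rules_def by blast
  moreover have "tapes ?P \<ge> 1" "finite (aux ?P)" "start ?P \<in> states ?P" "accepting ?P \<subseteq> states ?P"
    using N ctrl(1) by (auto simp: prod_ntm_def ntm_def)
  ultimately show ?thesis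
    using fin unfolding ntm_def ok_def by blast
qed

section \<open>Correctness of the lockstep simulation\<close>

definition sim_config :: "(nat, nat) config list \<Rightarrow> bool list \<Rightarrow> (nat, nat) config" where
  "sim_config cs ms = (to_nat (Sim (map fst cs) ms), concat (map snd cs))"

text \<open>An invariant of runs of \<open>N\<close>. Whole tapes have to stay in the alphabet
  because a head may later reach any cell; only then does each view lie in \<open>views N\<close>,
  over which the rules range.\<close>

definition valid :: "('q, 'g) ntm \<Rightarrow> ('q, 'g) config \<Rightarrow> bool" where
  "valid N c \<longleftrightarrow> fst c \<in> states N \<and> length (snd c) = tapes N \<and>
     (\<forall>t \<in> set (snd c). range (fst t) \<subseteq> alphabet N)"

lemma read_eq: "read t = fst t (snd t)"
  by (cases t) simp

lemma range_act: "range (fst (act a t)) \<subseteq> insert (fst a) (range (fst t))"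
  by (cases a; cases t) auto

lemma view_valid:
  assumes "valid N c" shows "view c \<in> views N"
proof -
  have "read t \<in> alphabet N" if "t \<in> set (snd c)" for t
    using assms that by (auto simp: valid_def read_eq subset_iff)
  then have "set (map read (snd c)) \<subseteq> alphabet N"
    unfolding set_map by (rule image_subsetI)
  then show ?thesis using assms by (simp add: valid_def views_def view_def)
qed

lemma valid_perform:
  assumes "ntm N" "valid N c" "m \<in> moves N (view c)"
  shows "valid N (perform m c)"
proof -
  note mv = moves_valid[OF assms(1) view_valid[OF assms(2)] assms(3)]
  have act: "range (fst (act a t)) \<subseteq> alphabet N" if "(a, t) \<in> set (zip (acts m (view c)) (snd c))" for a t
  proof -
    have "fst a \<in> alphabet N" using set_zip_leftD[OF that] mv(3) by blast
    moreover have "range (fst t) \<subseteq> alphabet N"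
      using set_zip_rightD[OF that] assms(2) by (simp add: valid_def)
    ultimately show ?thesis by (intro order_trans[OF range_act] insert_subsetI)
  qed
  have "\<forall>t \<in> set (map2 act (acts m (view c)) (snd c)). range (fst t) \<subseteq> alphabet N"
  proof (intro ballI)
    fix t' assume "t' \<in> set (map2 act (acts m (view c)) (snd c))"
    then obtain p where "p \<in> set (zip (acts m (view c)) (snd c))" "t' = act (fst p) (snd p)"
      unfolding set_map case_prod_beta by (elim imageE)
    then show "range (fst t') \<subseteq> alphabet N" using act[of "fst p" "snd p"] by simp
  qed
  then show ?thesis
    using mv assms(2) by (simp add: valid_def perform_def)
qed

text \<open>All views in \<open>views N\<close> have the same number of symbols, so the flat list
  read by the product machine determines the view of every copy.\<close>

lemma views_list_eq:
  assumes "set vs \<subseteq> views N" "set vs' \<subseteq> views N"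
    and "map fst vs = map fst vs'" "concat (map snd vs) = concat (map snd vs')"
  shows "vs = vs'"
proof -
  have len: "length vs = length vs'" using assms(3) by (rule map_eq_imp_length_eq)
  have "length x = length y" if xy: "(x, y) \<in> set (zip (map snd vs) (map snd vs'))" for x y
  proof -
    obtain v where "v \<in> set vs" "x = snd v"
      using set_zip_leftD[OF xy] unfolding set_map by (elim imageE)
    moreover obtain w where "w \<in> set vs'" "y = snd w"
      using set_zip_rightD[OF xy] unfolding set_map by (elim imageE)
    ultimately show ?thesis
      using subsetD[OF assms(1), of v] subsetD[OF assms(2), of w] by (simp add: views_def mem_Times_iff)
  qed
  then have "map snd vs = map snd vs'"
    using len assms(4) by (intro concat_inject) simp_all
  then show ?thesis using assms(3) by (rule pair_list_eqI[rotated])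
qed

lemma view_sim_config:
  "view (sim_config cs ms) =
    (to_nat (Sim (map fst (map view cs)) ms), concat (map snd (map view cs)))"
  by (simp add: view_def sim_config_def map_concat comp_def)

lemma enabled_sim:
  assumes "\<forall>c \<in> set cs. valid N c" "length cs = Suc K" "length ms = K"
  shows "enabled (prod_ntm N K wt) (view (sim_config cs ms)) =
    sim_trans (map view cs) ms ` {mvs. list_all2 (\<lambda>m c. m \<in> moves N (view c)) mvs cs \<and>
       (\<exists>m \<in> set mvs. m \<noteq> None) \<and> ordered ms (map to_nat mvs)} \<union>
    done_trans (map view cs) ms ` {i. i < wt ms \<and>
       (\<forall>c \<in> set cs. enabled N (view c) = {} \<and> fst c \<in> accepting N)}"
    (is "_ = ?S \<union> ?D")
proof -
  have vs: "set (map view cs) \<subseteq> views N" 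
    unfolding set_map by (rule image_subsetI) (use assms(1) view_valid in blast)
  have eq: "vs = map view cs" if "set vs \<subseteq> views N" "map fst vs = map fst (map view cs)"
    "concat (map snd vs) = concat (map snd (map view cs))" for vs
    using views_list_eq[OF that(1) vs that(2,3)] .
  have l: "list_all2 (\<lambda>m v. m \<in> moves N v) mvs (map view cs) \<longleftrightarrow>
      list_all2 (\<lambda>m c. m \<in> moves N (view c)) mvs cs" for mvs
    by (simp add: list_all2_map2)
  show ?thesis
  proof (intro equalityI subsetI)
    fix t assume "t \<in> enabled (prod_ntm N K wt) (view (sim_config cs ms))"
    then have t: "t \<in> trans (prod_ntm N K wt)"
      and q: "fst t = to_nat (Sim (map fst (map view cs)) ms)"
      and rs: "fst (snd t) = concat (map snd (map view cs))"
      unfolding enabled_def view_sim_config by auto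
    have "t \<notin> copy_rules N K"
      using q by (auto simp: copy_rules_def fwd_trans_def input_trans_def)
    then have "t \<in> sim_rules N K \<or> t \<in> done_rules N K wt" using t by (simp add: prod_ntm_def)
    then consider (1) vs ms' mvs where "t = sim_trans vs ms' mvs" "set vs \<subseteq> views N"
        "list_all2 (\<lambda>m v. m \<in> moves N v) mvs vs" "\<exists>m \<in> set mvs. m \<noteq> None"
        "ordered ms' (map to_nat mvs)"
      | (2) vs ms' i where "t = done_trans vs ms' i" "set vs \<subseteq> views N"
        "\<forall>v \<in> set vs. enabled N v = {} \<and> fst v \<in> accepting N" "i < wt ms'"
      unfolding sim_rules_def done_rules_def by blast
    then show "t \<in> ?S \<union> ?D"
    proof cases
      case 1
      then have "ms' = ms" "vs = map view cs"
        using q rs eq[of vs] by (simp_all add: sim_trans_def)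
      then show ?thesis using 1 l by auto
    next
      case 2
      then have "ms' = ms" "vs = map view cs"
        using q rs eq[of vs] by (simp_all add: done_trans_def)
      then show ?thesis using 2 by (auto simp: view_def)
    qed
  next
    fix t assume "t \<in> ?S \<union> ?D"
    then show "t \<in> enabled (prod_ntm N K wt) (view (sim_config cs ms))"
    proof
      assume "t \<in> ?S"
      then obtain mvs where mvs: "t = sim_trans (map view cs) ms mvs"
        "list_all2 (\<lambda>m v. m \<in> moves N v) mvs (map view cs)" "\<exists>m \<in> set mvs. m \<noteq> None"
        "ordered ms (map to_nat mvs)" using l by blast
      moreover have "length (map view cs) = Suc K" using assms(2) by simp
      ultimately have "t \<in> sim_rules N K"
        using vs assms(3) unfolding sim_rules_def by blast
      moreover have "(fst t, fst (snd t)) = view (sim_config cs ms)"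
        unfolding mvs(1) view_sim_config by (simp add: sim_trans_def)
      ultimately show ?thesis by (simp add: enabled_def prod_ntm_def)
    next
      assume "t \<in> ?D"
      then obtain i where i: "t = done_trans (map view cs) ms i" "i < wt ms"
        "\<forall>v \<in> set (map view cs). enabled N v = {} \<and> fst v \<in> accepting N"
        by (auto simp: view_def)
      moreover have "length (map view cs) = Suc K" using assms(2) by simp
      ultimately have "t \<in> done_rules N K wt"
        using vs assms(3) unfolding done_rules_def by blast
      moreover have "(fst t, fst (snd t)) = view (sim_config cs ms)"
        unfolding i(1) view_sim_config by (simp add: done_trans_def)
      ultimately show ?thesis by (simp add: enabled_def prod_ntm_def)
    qed
  qed
qed

lemma exec_sim:
  assumes "ntm N" "\<forall>c \<in> set cs. valid N c"
    and mvs: "list_all2 (\<lambda>m c. m \<in> moves N (view c)) mvs cs"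
  shows "exec (sim_trans (map view cs) ms mvs) (sim_config cs ms) =
    sim_config (map2 perform mvs cs) (marks ms (map to_nat mvs))"
proof -
  have len: "length mvs = length cs" using mvs by (rule list_all2_lengthD)
  have la: "length (acts (mvs ! i) (view (cs ! i))) = length (snd (cs ! i))" if "i < length cs" for i
  proof -
    have v: "valid N (cs ! i)" using that assms(2) nth_mem by blast
    have "mvs ! i \<in> moves N (view (cs ! i))" using that mvs by (rule list_all2_nthD2[rotated])
    then have "length (acts (mvs ! i) (view (cs ! i))) = tapes N"
      by (rule moves_valid(2)[OF assms(1) view_valid[OF v]])
    then show ?thesis using v by (simp add: valid_def)
  qed
  have "list_all2 (\<lambda>xs ys. length xs = length ys) (map2 acts mvs (map view cs)) (map snd cs)"
    using la len by (simp add: list_all2_conv_all_nth)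
  then have "map2 act (concat (map2 acts mvs (map view cs))) (concat (map snd cs)) =
    concat (map2 (map2 act) (map2 acts mvs (map view cs)) (map snd cs))" by (rule map2_concat)
  also have "map2 (map2 act) (map2 acts mvs (map view cs)) (map snd cs) =
      map snd (map2 perform mvs cs)"
    using len by (intro nth_equalityI) (auto simp: perform_def)
  finally have "map2 act (concat (map2 acts mvs (map view cs))) (concat (map snd cs)) =
    concat (map snd (map2 perform mvs cs))" .
  moreover have "map2 target mvs (map view cs) = map fst (map2 perform mvs cs)"
    using len by (intro nth_equalityI) (auto simp: perform_def)
  ultimately show ?thesis by (simp add: exec_def sim_trans_def sim_config_def)
qed

text \<open>Paths are counted per transition but tuples per joint move. The two sums agree only if
  different joint moves give different transitions.\<close>

lemma inj_on_sim_trans: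
  assumes "ntm N" "\<forall>c \<in> set cs. valid N c"
  shows "inj_on (sim_trans (map view cs) ms) {mvs. list_all2 (\<lambda>m c. m \<in> moves N (view c)) mvs cs}"
proof (rule inj_onI)
  fix xs ys
  assume "xs \<in> {mvs. list_all2 (\<lambda>m c. m \<in> moves N (view c)) mvs cs}"
    and "ys \<in> {mvs. list_all2 (\<lambda>m c. m \<in> moves N (view c)) mvs cs}"
    and eq: "sim_trans (map view cs) ms xs = sim_trans (map view cs) ms ys"
  then have xs: "list_all2 (\<lambda>m c. m \<in> moves N (view c)) xs cs"
    and ys: "list_all2 (\<lambda>m c. m \<in> moves N (view c)) ys cs" by simp_all
  have len: "length xs = length cs" "length ys = length cs" using xs ys by (auto dest: list_all2_lengthD)
  have la: "length a = tapes N"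
    if zs: "list_all2 (\<lambda>m c. m \<in> moves N (view c)) zs cs" and a: "a \<in> set (map2 acts zs (map view cs))"
    for zs a
  proof -
    obtain i where i: "i < length cs" "a = acts (zs ! i) (view (cs ! i))"
      using a by (auto simp: in_set_conv_nth)
    have v: "valid N (cs ! i)" using i(1) assms(2) nth_mem by blast
    have "zs ! i \<in> moves N (view (cs ! i))" using i(1) zs by (rule list_all2_nthD2[rotated])
    then show ?thesis
      unfolding i(2) by (rule moves_valid(2)[OF assms(1) view_valid[OF v]])
  qed
  have "length a = length b"
    if "(a, b) \<in> set (zip (map2 acts xs (map view cs)) (map2 acts ys (map view cs)))" for a b
    using la[OF xs set_zip_leftD[OF that]] la[OF ys set_zip_rightD[OF that]] by simp
  moreover have "concat (map2 acts xs (map view cs)) = concat (map2 acts ys (map view cs))"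
    using eq by (simp add: sim_trans_def)
  moreover have "length (map2 acts xs (map view cs)) = length (map2 acts ys (map view cs))"
    using len by simp
  ultimately have acts: "map2 acts xs (map view cs) = map2 acts ys (map view cs)"
    by (intro concat_inject)
  have target: "map2 target xs (map view cs) = map2 target ys (map view cs)"
    using eq by (simp add: sim_trans_def)
  show "xs = ys"
  proof (rule nth_equalityI)
    fix i assume "i < length xs"
    then have i: "i < length cs" using len by simp
    show "xs ! i = ys ! i"
    proof (rule moves_inject)
      show "xs ! i \<in> moves N (view (cs ! i))" using xs i by (rule list_all2_nthD2)
      show "ys ! i \<in> moves N (view (cs ! i))" using ys i by (rule list_all2_nthD2)
      show "target (xs ! i) (view (cs ! i)) = target (ys ! i) (view (cs ! i))"
        using arg_cong[OF target, of "\<lambda>l. l ! i"] i len by simp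
      show "acts (xs ! i) (view (cs ! i)) = acts (ys ! i) (view (cs ! i))"
        using arg_cong[OF acts, of "\<lambda>l. l ! i"] i len by simp
    qed
  qed (use len in simp)
qed

lemma accepting_prod:
  "to_nat s \<in> accepting (prod_ntm N K wt) \<longleftrightarrow> (\<exists>i ms. s = Done i \<and> length ms = K \<and> i < wt ms)"
  by (auto simp: prod_ntm_def)

lemma enabled_done: "enabled (prod_ntm N K wt) (to_nat (Done i), rs) = {}"
  by (auto simp: enabled_def prod_ntm_def copy_rules_def sim_rules_def done_rules_def
      fwd_trans_def input_trans_def sim_trans_def done_trans_def)

text \<open>Only final rules are enabled here, \<open>wt ms\<close> of them if every copy accepts.
  Each accepting copy has a single code list, the all-idle one, so the sum has at most one term. The
  lengths \<open>b\<close> and \<open>b'\<close> are independent, since a halted configuration meets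
  every bound.\<close>

lemma counts_sim_halted:
  assumes N: "ntm N" and wt: "\<And>ms. wt ms \<le> W"
    and cs: "\<forall>c \<in> set cs. valid N c" "length cs = Suc K" "length ms = K"
    and halted: "\<And>c. c \<in> set cs \<Longrightarrow> enabled N (view c) = {}"
  shows "counts (prod_ntm N K wt) (sim_config cs ms) (Suc b)
    (\<Sum>ps | list_all2 (\<lambda>p c. p \<in> codes N b' c) ps cs. weight wt ms ps)"
proof -
  let ?P = "prod_ntm N K wt"
  let ?c = "sim_config cs ms"
  let ?E = "enabled ?P (view ?c)"
  have "m = None" if m: "list_all2 (\<lambda>m c. m \<in> moves N (view c)) mvs cs" "m \<in> set mvs" for mvs m
  proof -
    obtain c where "c \<in> set cs" "m \<in> moves N (view c)" using list_all2_ex[OF m] by blast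
    then show ?thesis using halted by (simp add: moves_def)
  qed
  then have no: "{mvs. list_all2 (\<lambda>m c. m \<in> moves N (view c)) mvs cs \<and>
       (\<exists>m \<in> set mvs. m \<noteq> None) \<and> ordered ms (map to_nat mvs)} = {}" by blast
  have E: "?E = done_trans (map view cs) ms ` {i. i < wt ms \<and>
       (\<forall>c \<in> set cs. enabled N (view c) = {} \<and> fst c \<in> accepting N)}"
    unfolding enabled_sim[OF cs] no by simp
  have "counts ?P (exec t ?c) b 1" if "t \<in> ?E" for t
  proof -
    obtain i where i: "t = done_trans (map view cs) ms i" "i < wt ms" using \<open>t \<in> ?E\<close> E by auto
    then have "fst (exec t ?c) = to_nat (Done i)" by (simp add: exec_def done_trans_def)
    moreover have "to_nat (Done i) \<in> accepting ?P" using i cs accepting_prod by blast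
    ultimately show ?thesis
      using counts_halted[of ?P "exec t ?c" b] enabled_done[of N K wt i] by (simp add: view_def)
  qed
  moreover have "fst ?c \<notin> accepting ?P" by (simp add: sim_config_def accepting_prod)
  ultimately have counts: "counts ?P ?c (Suc b) (card ?E)"
    using counts_step[of ?P ?c b "\<lambda>_. 1"] ntm_prod[OF N wt] by simp
  let ?none = "to_nat (None :: (nat, nat) transition option)"
  have "(\<Sum>ps | list_all2 (\<lambda>p c. p \<in> codes N b' c) ps cs. weight wt ms ps) = card ?E"
  proof (cases "\<forall>c \<in> set cs. fst c \<in> accepting N")
    case True
    have "codes N b' (cs ! i) = {replicate b' ?none}" if "i < Suc K" for i
      using codes_halted[OF halted[of "cs ! i"]] True that cs(2) by simp
    then have "list_all2 (\<lambda>p c. p \<in> codes N b' c) ps cs \<longleftrightarrow>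
        ps = replicate (Suc K) (replicate b' ?none)" for ps
      using cs(2) by (auto simp: list_all2_conv_all_nth list_eq_iff_nth_eq[of ps] simp del: replicate_Suc)
    then have "(\<Sum>ps | list_all2 (\<lambda>p c. p \<in> codes N b' c) ps cs. weight wt ms ps) = wt ms"
      using weight_replicate[of wt ms] cs(3) by (simp del: replicate_Suc)
    moreover have "card ?E = wt ms"
      unfolding E using True halted
      by (subst card_image) (auto simp: inj_on_def done_trans_def)
    ultimately show ?thesis by simp
  next
    case False
    then obtain c where c: "c \<in> set cs" "fst c \<notin> accepting N" by blast
    then have "codes N b' c = {}" using codes_halted[OF halted] by simp
    then have "{ps. list_all2 (\<lambda>p c. p \<in> codes N b' c) ps cs} = {}"
      using c(1) by (force simp: list_all2_conv_all_nth in_set_conv_nth)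
    moreover have "?E = {}" unfolding E using c by blast
    ultimately show ?thesis by simp
  qed
  then show ?thesis using counts by simp
qed

text \<open>By induction on \<open>b\<close>: a product step is an ordered joint move, and by
  \<open>sum_tuples_Suc\<close> and \<open>weight_Cons\<close> the weighted sum unfolds in the same
  way. The extra step in \<open>Suc b\<close> is the one into a \<open>Done\<close> state.\<close>

lemma counts_sim:
  assumes N: "ntm N" and wt: "\<And>ms. wt ms \<le> W"
    and "\<And>c. c \<in> set cs \<Longrightarrow> valid N c \<and> runtime_le N c b" "length cs = Suc K" "length ms = K"
  shows "counts (prod_ntm N K wt) (sim_config cs ms) (Suc b)
    (\<Sum>ps | list_all2 (\<lambda>p c. p \<in> codes N b c) ps cs. weight wt ms ps)"
  using assms(3-5)
proof (induction b arbitrary: cs ms)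
  case 0
  have "\<forall>c \<in> set cs. valid N c" using 0(1) by blast
  moreover have "enabled N (view c) = {}" if "c \<in> set cs" for c
    using 0(1)[OF that] by (simp add: runtime_le_0)
  ultimately show ?case by (rule counts_sim_halted[OF N wt _ 0(2,3)])
next
  case (Suc b)
  let ?P = "prod_ntm N K wt"
  let ?c = "sim_config cs ms"
  let ?E = "enabled ?P (view ?c)"
  have valid: "\<forall>c \<in> set cs. valid N c" using Suc.prems(1) by blast
  show ?case
  proof (cases "\<forall>c \<in> set cs. enabled N (view c) = {}")
    \<comment> \<open>All copies may halt before the time bound is used up.\<close>
    case True
    then show ?thesis
      by (intro counts_sim_halted[OF N wt valid Suc.prems(2,3)]) blast+
  next
    case False
    let ?M = "{mvs. list_all2 (\<lambda>m c. m \<in> moves N (view c)) mvs cs}"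
    let ?O = "{mvs \<in> ?M. ordered ms (map to_nat mvs)}"
    let ?s = "sim_trans (map view cs) ms"
    let ?g = "\<lambda>mvs. \<Sum>ps | list_all2 (\<lambda>p c. p \<in> codes N b c) ps (map2 perform mvs cs).
      weight wt (marks ms (map to_nat mvs)) ps"
    \<comment> \<open>A copy that has not halted has no idle move, so every joint move satisfies the
      progress condition of \<open>sim_rules\<close>.\<close>
    have "\<exists>m \<in> set mvs. m \<noteq> None" if "mvs \<in> ?M" for mvs
    proof -
      obtain c where "c \<in> set cs" "enabled N (view c) \<noteq> {}" using False by blast
      then obtain i where i: "i < length cs" "enabled N (view (cs ! i)) \<noteq> {}"
        by (metis in_set_conv_nth)
      then have "mvs ! i \<in> moves N (view (cs ! i))" "i < length mvs"
        using that list_all2_nthD2[of _ mvs cs] list_all2_lengthD[of _ mvs cs] by simp_all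
      then have "mvs ! i \<noteq> None" using i(2) by (auto simp: moves_def)
      then show ?thesis using nth_mem[OF \<open>i < length mvs\<close>] by blast
    qed
    then have O: "{mvs. list_all2 (\<lambda>m c. m \<in> moves N (view c)) mvs cs \<and>
       (\<exists>m \<in> set mvs. m \<noteq> None) \<and> ordered ms (map to_nat mvs)} = ?O" by blast
    have D: "{i. i < wt ms \<and>
       (\<forall>c \<in> set cs. enabled N (view c) = {} \<and> fst c \<in> accepting N)} = {}" using False by blast
    have E: "?E = ?s ` ?O"
      unfolding enabled_sim[OF valid Suc.prems(2,3)] O D by (simp only: image_empty Un_empty_right)
    have inj: "inj_on ?s ?O"
      using inj_on_sim_trans[OF N valid] by (rule inj_on_subset) blast
    have g: "counts ?P (exec (?s mvs) ?c) (Suc b) (?g mvs)" if "mvs \<in> ?O" for mvs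
    proof -
      have mvs: "list_all2 (\<lambda>m c. m \<in> moves N (view c)) mvs cs" using that by simp
      have "valid N d \<and> runtime_le N d b" if d: "d \<in> set (map2 perform mvs cs)" for d
      proof -
        obtain p where p: "p \<in> set (zip mvs cs)" "d = perform (fst p) (snd p)"
          using d unfolding set_map case_prod_beta by (elim imageE)
        have mem: "snd p \<in> set cs" using set_zip_rightD[of "fst p" "snd p" mvs cs] p(1) by simp
        have m: "fst p \<in> moves N (view (snd p))"
          using mvs p(1) unfolding list_all2_iff case_prod_beta by blast
        have v: "valid N (snd p)" "runtime_le N (snd p) (Suc b)"
          using Suc.prems(1)[OF mem] by simp_all
        show ?thesis
          unfolding p(2) using valid_perform[OF N v(1) m] runtime_le_perform[OF v(2) m] by (rule conjI)
      qed
      moreover have "length (map2 perform mvs cs) = Suc K"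
        using Suc.prems(2) list_all2_lengthD[OF mvs] by simp
      moreover have "length (marks ms (map to_nat mvs)) = K" using Suc.prems(3) by simp
      ultimately show ?thesis
        unfolding exec_sim[OF N valid mvs] by (rule Suc.IH)
    qed
    \<comment> \<open>\<open>counts_step\<close> needs a function of transitions, so
      \<open>?g\<close> is carried over along the injection \<open>?s\<close>.\<close>
    define F where "F = (\<lambda>t. ?g (inv_into ?O ?s t))"
    have F: "F (?s mvs) = ?g mvs" if "mvs \<in> ?O" for mvs
      unfolding F_def inv_into_f_f[OF inj that] ..
    have "counts ?P (exec t ?c) (Suc b) (F t)" if "t \<in> ?E" for t
    proof -
      obtain mvs where m: "mvs \<in> ?O" "t = ?s mvs" using \<open>t \<in> ?E\<close> unfolding E by blast
      show ?thesis unfolding m(2) F[OF m(1)] by (rule g[OF m(1)])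
    qed
    moreover have "fst ?c \<notin> accepting ?P" by (simp add: sim_config_def accepting_prod)
    ultimately have "counts ?P ?c (Suc (Suc b)) (\<Sum>t \<in> ?E. F t)"
      by (intro counts_step ntm_prod[OF N wt])
    moreover have "(\<Sum>t \<in> ?E. F t) = (\<Sum>mvs \<in> ?O. ?g mvs)"
      unfolding E sum.reindex[OF inj] comp_def by (rule sum.cong[OF refl F])
    moreover have "(\<Sum>ps | list_all2 (\<lambda>p c. p \<in> codes N (Suc b) c) ps cs. weight wt ms ps) =
      (\<Sum>mvs \<in> ?O. ?g mvs)"
    proof -
      have w: "weight wt ms (map2 (#) (map to_nat mvs) ps) = (if ordered ms (map to_nat mvs)
          then weight wt (marks ms (map to_nat mvs)) ps else 0)"
        if "mvs \<in> ?M" "list_all2 (\<lambda>p c. p \<in> codes N b c) ps (map2 perform mvs cs)" for mvs ps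
      proof (rule weight_Cons)
        have "length mvs = length cs" using that(1) by (simp add: list_all2_lengthD)
        then show "length (map to_nat mvs) = Suc (length ms)" "length ps = Suc (length ms)"
          using list_all2_lengthD[OF that(2)] Suc.prems(2,3) by simp_all
      qed
      \<comment> \<open>Joint moves that violate the order contribute 0, so the sum over all joint
        moves reduces to the ordered ones.\<close>
      have "(\<Sum>ps | list_all2 (\<lambda>p c. p \<in> codes N (Suc b) c) ps cs. weight wt ms ps) =
        (\<Sum>mvs \<in> ?M. if ordered ms (map to_nat mvs) then ?g mvs else 0)"
        unfolding sum_tuples_Suc[OF N]
      proof (rule sum.cong[OF refl])
        fix mvs assume mvs: "mvs \<in> ?M"
        let ?T = "{ps. list_all2 (\<lambda>p c. p \<in> codes N b c) ps (map2 perform mvs cs)}"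
        have "(\<Sum>ps \<in> ?T. weight wt ms (map2 (#) (map to_nat mvs) ps)) =
          (\<Sum>ps \<in> ?T. if ordered ms (map to_nat mvs)
            then weight wt (marks ms (map to_nat mvs)) ps else 0)"
          using w[OF mvs] by (intro sum.cong[OF refl]) blast
        then show "(\<Sum>ps \<in> ?T. weight wt ms (map2 (#) (map to_nat mvs) ps)) =
          (if ordered ms (map to_nat mvs) then ?g mvs else 0)" by (cases "ordered ms (map to_nat mvs)") simp_all
      qed
      also have "\<dots> = (\<Sum>mvs \<in> ?O. ?g mvs)"
        by (intro sum.inter_filter[symmetric] finite_list_all2 finite_moves N)
      finally show ?thesis .
    qed
    ultimately show ?thesis by simp
  qed
qed

section \<open>Copying the input to all groups of tapes\<close>

definition tape_content :: "bool list \<Rightarrow> int \<Rightarrow> 'g symbol" where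
  "tape_content x = fst (input_tape x)"

abbreviation blank_tape :: "'g tape" where
  "blank_tape \<equiv> (\<lambda>_. Blank, 0)"

definition fwd_config :: "(nat, nat) ntm \<Rightarrow> nat \<Rightarrow> bool list \<Rightarrow> nat \<Rightarrow> (nat, nat) config" where
  "fwd_config N K x i = (to_nat Fwd, concat (grp N (tape_content x, int i) blank_tape #
     replicate K (grp N (tape_content (take i x), int i) blank_tape)))"

text \<open>The position is an integer because the heads return as far as the blank cell -1.\<close>

definition back_config :: "(nat, nat) ntm \<Rightarrow> nat \<Rightarrow> bool list \<Rightarrow> int \<Rightarrow> (nat, nat) config" where
  "back_config N K x h =
     (to_nat Back, concat (replicate (Suc K) (grp N (tape_content x, h) blank_tape)))"

lemma input_tape_eq: "input_tape x = (tape_content x, 0)"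
  by (simp add: tape_content_def input_tape_def)

lemma tape_content_nth: "i < length x \<Longrightarrow> tape_content x (int i) = Bit (x ! i)"
  by (simp add: tape_content_def input_tape_def)

lemma tape_content_outside: "h < 0 \<or> int (length x) \<le> h \<Longrightarrow> tape_content x h = Blank"
  by (auto simp: tape_content_def input_tape_def)

lemma tape_content_Nil: "tape_content [] = (\<lambda>_. Blank)"
  by (rule ext) (simp add: tape_content_def input_tape_def)

lemma tape_content_take_Suc:
  assumes "i < length x"
  shows "(tape_content (take i x))(int i := Bit (x ! i)) = tape_content (take (Suc i) x)"
proof
  fix j
  have "nat j < Suc i" if "0 \<le> j" "j < 1 + int i" using that by linarith
  then show "((tape_content (take i x))(int i := Bit (x ! i))) j = tape_content (take (Suc i) x) j"
    using assms by (auto simp: tape_content_def input_tape_def)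
qed

lemma init_eq: "init N x = (start N, grp N (input_tape x) blank_tape)"
  by (simp add: init_def grp_def)

lemma valid_init:
  assumes "ntm N" shows "valid N (init N x)"
proof -
  have "tape_content x h \<in> alphabet N" for h
    by (simp add: tape_content_def input_tape_def)
  then have "range (fst t) \<subseteq> alphabet N" if "t \<in> set (grp N (input_tape x) blank_tape)" for t
    using subsetD[OF set_grp that] by (auto simp: input_tape_eq)
  then show ?thesis
    using assms length_grp[OF assms] unfolding valid_def init_eq by (simp add: ntm_def)
qed

lemma map_grp: "map f (grp N a b) = grp N (f a) (f b)"
  by (simp add: grp_def)

lemma map2_act_grp:
  "map2 act (grp N a (Blank, Stay)) (grp N t blank_tape) = grp N (act a t) blank_tape"
  by (simp add: grp_def fun_upd_idem)

text \<open>The tapes \<open>t\<close> and \<open>u\<close> differ while the input is being copied;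
  \<open>t = u\<close> covers the turn and the return.\<close>

lemma map2_act_copies:
  "map2 act (concat (replicate (Suc K) (grp N a (Blank, Stay))))
     (concat (grp N t blank_tape # replicate K (grp N u blank_tape))) =
   concat (grp N (act a t) blank_tape # replicate K (grp N (act a u) blank_tape))"
proof -
  have "list_all2 (\<lambda>xs ys. length xs = length ys) (replicate K (grp N a (Blank, Stay)))
      (replicate K (grp N u blank_tape))"
    by (simp add: list_all2_conv_all_nth grp_def)
  moreover have "length (grp N a (Blank, Stay)) = length (grp N t blank_tape)"
    by (simp add: grp_def)
  ultimately have "list_all2 (\<lambda>xs ys. length xs = length ys) (replicate (Suc K) (grp N a (Blank, Stay)))
      (grp N t blank_tape # replicate K (grp N u blank_tape))"
    by simp
  then show ?thesis
    by (subst map2_concat) (simp_all add: map2_act_grp zip_replicate)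
qed

lemma view_fwd_config:
  "view (fwd_config N K x i) = (to_nat Fwd, concat (grp N (tape_content x (int i)) Blank #
     replicate K (grp N (tape_content (take i x) (int i)) Blank)))"
  by (simp add: view_def fwd_config_def map_concat map_grp)

lemma view_back_config:
  "view (back_config N K x h) = (to_nat Back, concat (replicate (Suc K) (grp N (tape_content x h) Blank)))"
  by (simp add: view_def back_config_def map_concat map_grp)

lemmas copy_defs = enabled_def prod_ntm_def copy_rules_def sim_rules_def done_rules_def
  fwd_trans_def input_trans_def sim_trans_def done_trans_def grp_def

text \<open>In the copying phases exactly one rule applies, here and in the next three lemmas. These
  phases cost time but leave the number of accepting paths unchanged.\<close>

lemma enabled_fwd_bit:
  "enabled (prod_ntm N K wt) (to_nat Fwd, concat (grp N (Bit b) Blank # replicate K (grp N Blank Blank)))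
    = {fwd_trans N K b}"
  by (auto simp: copy_defs)

lemma enabled_fwd_blank:
  "enabled (prod_ntm N K wt) (to_nat Fwd, concat (replicate (Suc K) (grp N Blank Blank)))
    = {input_trans N K Fwd Blank Back Left}"
  by (auto simp: copy_defs)

lemma enabled_back_bit:
  "enabled (prod_ntm N K wt) (to_nat Back, concat (replicate (Suc K) (grp N (Bit b) Blank)))
    = {input_trans N K Back (Bit b) Back Left}"
  by (auto simp: copy_defs)

lemma enabled_back_blank:
  "enabled (prod_ntm N K wt) (to_nat Back, concat (replicate (Suc K) (grp N Blank Blank)))
    = {input_trans N K Back Blank (sim_start N K) Right}"
  by (auto simp: copy_defs)

lemma exec_input:
  "exec (input_trans N K s r s' d) (q, concat (replicate (Suc K) (grp N (f, h) blank_tape))) =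
    (to_nat s', concat (replicate (Suc K) (grp N (f(h := r), h + offset d) blank_tape)))"
  using map2_act_copies[of K N "(r, d)" "(f, h)" "(f, h)"]
  by (simp add: exec_def input_trans_def)

lemma exec_fwd:
  assumes "i < length x"
  shows "exec (fwd_trans N K (x ! i)) (fwd_config N K x i) = fwd_config N K x (Suc i)"
  using map2_act_copies[of K N "(Bit (x ! i), Right)" "(tape_content x, int i)"
      "(tape_content (take i x), int i)"]
  by (simp add: exec_def fwd_trans_def fwd_config_def add.commute
      fun_upd_idem tape_content_nth[OF assms] tape_content_take_Suc[OF assms])

text \<open>From cell \<open>j - 1\<close> there are \<open>j\<close> steps left to the blank cell
  -1, and one step right onto cell 0 starts the simulation.\<close>

lemma counts_back:
  assumes N: "ntm N" and wt: "\<And>ms. wt ms \<le> W" and "j \<le> length x"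
    and sim: "counts (prod_ntm N K wt)
      (sim_config (replicate (Suc K) (init N x)) (replicate K False)) b n"
  shows "counts (prod_ntm N K wt) (back_config N K x (int j - 1)) (Suc j + b) n"
  using assms(3)
proof (induction j)
  case 0
  have "counts (prod_ntm N K wt) (back_config N K x (- 1)) (Suc b) n"
  proof (rule counts_det[OF ntm_prod[OF N wt]])
    show "enabled (prod_ntm N K wt) (view (back_config N K x (- 1))) =
        {input_trans N K Back Blank (sim_start N K) Right}"
      unfolding view_back_config using enabled_back_blank by (simp add: tape_content_outside del: replicate_Suc)
    have "exec (input_trans N K Back Blank (sim_start N K) Right) (back_config N K x (- 1)) =
        sim_config (replicate (Suc K) (init N x)) (replicate K False)"
      unfolding back_config_def exec_input sim_config_def
      by (simp add: init_eq input_tape_eq tape_content_outside fun_upd_idem del: replicate_Suc)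
    then show "counts (prod_ntm N K wt)
        (exec (input_trans N K Back Blank (sim_start N K) Right) (back_config N K x (- 1))) b n"
      using sim by simp
  qed (simp add: back_config_def accepting_prod)
  then show ?case by simp
next
  case (Suc j)
  then have j: "tape_content x (int j) = Bit (x ! j)" by (simp add: tape_content_nth)
  have "counts (prod_ntm N K wt) (back_config N K x (int j)) (Suc (Suc j + b)) n"
  proof (rule counts_det[OF ntm_prod[OF N wt]])
    show "enabled (prod_ntm N K wt) (view (back_config N K x (int j))) =
        {input_trans N K Back (Bit (x ! j)) Back Left}"
      unfolding view_back_config j by (rule enabled_back_bit)
    have "exec (input_trans N K Back (Bit (x ! j)) Back Left) (back_config N K x (int j)) =
        back_config N K x (int j - 1)"
      unfolding back_config_def exec_input by (simp add: fun_upd_idem j del: replicate_Suc)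
    then show "counts (prod_ntm N K wt)
        (exec (input_trans N K Back (Bit (x ! j)) Back Left) (back_config N K x (int j))) (Suc j + b) n"
      using Suc by simp
  qed (simp add: back_config_def accepting_prod)
  then show ?case by simp
qed

text \<open>One step for each input bit still to be copied and one to turn around at the blank after
  the input.\<close>

lemma counts_fwd:
  assumes N: "ntm N" and wt: "\<And>ms. wt ms \<le> W" and "i \<le> length x"
    and ret: "counts (prod_ntm N K wt) (back_config N K x (int (length x) - 1)) b n"
  shows "counts (prod_ntm N K wt) (fwd_config N K x i) (Suc (length x - i) + b) n"
  using assms(3)
proof (induction rule: inc_induct)
  case base
  have fwd: "fwd_config N K x (length x) =
      (to_nat Fwd, concat (replicate (Suc K) (grp N (tape_content x, int (length x)) blank_tape)))"
    by (simp add: fwd_config_def)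
  have "counts (prod_ntm N K wt) (fwd_config N K x (length x)) (Suc b) n"
  proof (rule counts_det[OF ntm_prod[OF N wt]])
    show "enabled (prod_ntm N K wt) (view (fwd_config N K x (length x))) =
        {input_trans N K Fwd Blank Back Left}"
      unfolding view_fwd_config using enabled_fwd_blank by (simp add: tape_content_outside)
    have "exec (input_trans N K Fwd Blank Back Left) (fwd_config N K x (length x)) =
        back_config N K x (int (length x) - 1)"
      unfolding fwd exec_input back_config_def
      by (simp add: tape_content_outside fun_upd_idem del: replicate_Suc)
    then show "counts (prod_ntm N K wt)
        (exec (input_trans N K Fwd Blank Back Left) (fwd_config N K x (length x))) b n"
      using ret by simp
  qed (simp add: fwd_config_def accepting_prod)
  then show ?case by simp
next
  case (step i)
  have "counts (prod_ntm N K wt) (fwd_config N K x i) (Suc (Suc (length x - Suc i) + b)) n"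
  proof (rule counts_det[OF ntm_prod[OF N wt]])
    show "enabled (prod_ntm N K wt) (view (fwd_config N K x i)) = {fwd_trans N K (x ! i)}"
      unfolding view_fwd_config using step.hyps enabled_fwd_bit
      by (simp add: tape_content_nth tape_content_outside)
    show "counts (prod_ntm N K wt) (exec (fwd_trans N K (x ! i)) (fwd_config N K x i))
        (Suc (length x - Suc i) + b) n"
      unfolding exec_fwd[OF step.hyps(2)] by (rule step.IH)
  qed (simp add: fwd_config_def accepting_prod)
  then show ?case using step.hyps by (simp add: Suc_diff_Suc)
qed

lemma concat_replicate_replicate: "concat (replicate m (replicate n a)) = replicate (m * n) a"
  by (induction m) (simp_all add: replicate_add)

text \<open>Before anything is copied, all tapes but the first are blank, so grouping them changes
  nothing.\<close>

lemma init_prod: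
  assumes "ntm N" shows "init (prod_ntm N K wt) x = fwd_config N K x 0"
proof -
  obtain t where t: "tapes N = Suc t" using assms by (auto simp: ntm_def dest: Suc_le_D)
  have "grp N blank_tape blank_tape = (replicate (Suc t) blank_tape :: nat tape list)"
    by (simp add: grp_def t)
  then have "concat (replicate K (grp N blank_tape blank_tape)) =
      (replicate (K * Suc t) blank_tape :: nat tape list)"
    by (simp only: concat_replicate_replicate)
  then have "fwd_config N K x 0 = (to_nat Fwd, input_tape x # replicate t blank_tape @
      replicate (K * Suc t) blank_tape)"
    by (simp add: fwd_config_def tape_content_Nil input_tape_eq grp_def t)
  also have "\<dots> = init (prod_ntm N K wt) x"
  proof -
    have "tapes (prod_ntm N K wt) - 1 = t + K * Suc t" by (simp add: prod_ntm_def t)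
    then show ?thesis unfolding init_def by (simp only: replicate_add) (simp add: prod_ntm_def)
  qed
  finally show ?thesis ..
qed

lemma counts_prod:
  assumes N: "ntm N" and wt: "\<And>ms. wt ms \<le> W" and b: "runtime_le N (init N x) b"
  shows "counts (prod_ntm N K wt) (init (prod_ntm N K wt) x) (2 * length x + 3 + b)
    (\<Sum>ps | length ps = Suc K \<and> set ps \<subseteq> codes N b (init N x). weight wt (replicate K False) ps)"
proof -
  have "counts (prod_ntm N K wt) (sim_config (replicate (Suc K) (init N x)) (replicate K False)) (Suc b)
    (\<Sum>ps | list_all2 (\<lambda>p c. p \<in> codes N b c) ps (replicate (Suc K) (init N x)).
      weight wt (replicate K False) ps)"
    using valid_init[OF N] b by (intro counts_sim[OF N wt]) (auto simp del: replicate_Suc)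
  note sim = counts_fwd[OF N wt le0 counts_back[OF N wt order_refl this]]
  have tuples: "list_all2 (\<lambda>p c. p \<in> codes N b c) ps (replicate (Suc K) (init N x)) \<longleftrightarrow>
      length ps = Suc K \<and> set ps \<subseteq> codes N b (init N x)" for ps
    by (auto simp: list_all2_conv_all_nth in_set_conv_nth subset_iff simp del: replicate_Suc)
  \<comment> \<open>Copying and returning take \<open>length x + 1\<close> steps each, the
    simulation at most \<open>b + 1\<close>.\<close>
  have time: "Suc (length x - 0) + (Suc (length x) + Suc b) = 2 * length x + 3 + b" by simp
  show ?thesis using sim unfolding init_prod[OF N] tuples time .
qed

section \<open>The choice of the weights\<close>

text \<open>Final marks equal to \<open>staircase K i\<close> witness a set of \<open>i + 1\<close> paths.\<close>

definition staircase :: "nat \<Rightarrow> nat \<Rightarrow> bool list" where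
  "staircase K i = replicate i True @ replicate (K - i) False"

lemma nth_staircase: "j < K \<Longrightarrow> i \<le> K \<Longrightarrow> staircase K i ! j \<longleftrightarrow> j < i"
  by (auto simp: staircase_def nth_append)

lemma card_strictly_sorted_lists:
  fixes S :: "'a :: linorder set"
  assumes "finite S"
  shows "card {ys. sorted_wrt (<) ys \<and> length ys = i \<and> set ys \<subseteq> S} = card S choose i"
proof -
  have "bij_betw set {ys. sorted_wrt (<) ys \<and> length ys = i \<and> set ys \<subseteq> S} {A. A \<subseteq> S \<and> card A = i}"
  proof (rule bij_betw_byWitness[where f' = sorted_list_of_set])
    note fin = finite_subset[OF _ assms]
    show "sorted_list_of_set ` {A. A \<subseteq> S \<and> card A = i}
        \<subseteq> {ys. sorted_wrt (<) ys \<and> length ys = i \<and> set ys \<subseteq> S}"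
      by (auto simp: fin)
    show "\<forall>A \<in> {A. A \<subseteq> S \<and> card A = i}. set (sorted_list_of_set A) = A"
      by (auto simp: fin)
  qed (auto simp: strict_sorted_iff distinct_card sorted_list_of_set.idem_if_sorted_distinct)
  then show ?thesis using n_subsets[OF assms] by (simp add: bij_betw_same_card)
qed

text \<open>Such a tuple increases strictly up to index \<open>i\<close> and is constant afterwards.
  It is a strictly sorted list of length \<open>Suc i\<close>, that is, a set of this size, padded
  by repeating its last entry.\<close>

lemma card_staircase:
  fixes S :: "'a :: linorder set"
  assumes "finite S" "i \<le> K"
  shows "card {ps. length ps = Suc K \<and> set ps \<subseteq> S \<and> ordered (replicate K False) ps \<and>
    marks (replicate K False) ps = staircase K i} = card S choose Suc i"
proof -
  let ?Y = "{ys. sorted_wrt (<) ys \<and> length ys = Suc i \<and> set ys \<subseteq> S}"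
  let ?D = "{ps. length ps = Suc K \<and> set ps \<subseteq> S \<and> ordered (replicate K False) ps \<and>
    marks (replicate K False) ps = staircase K i}"
  let ?f = "\<lambda>ys. ys @ replicate (K - i) (last ys)"
  have D: "ps \<in> ?D \<longleftrightarrow> length ps = Suc K \<and> set ps \<subseteq> S \<and>
      (\<forall>j < K. ps ! j \<le> ps ! Suc j \<and> (ps ! j \<noteq> ps ! Suc j \<longleftrightarrow> j < i))" for ps
    using assms(2) by (auto simp: ordered_def marks_def list_eq_iff_nth_eq nth_staircase)
      (auto simp: staircase_def)
  have "?D = ?f ` ?Y"
  proof (intro equalityI subsetI)
    fix ps assume "ps \<in> ?D"
    then have ps: "length ps = Suc K" "set ps \<subseteq> S" "\<And>j. j < K \<Longrightarrow> ps ! j \<le> ps ! Suc j"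
      "\<And>j. j < K \<Longrightarrow> ps ! j \<noteq> ps ! Suc j \<longleftrightarrow> j < i" unfolding D by auto
    define ys where "ys = take (Suc i) ps"
    have len: "length ys = Suc i" using ps(1) assms(2) by (simp add: ys_def)
    have "sorted_wrt (<) ys"
      using ps(3,4) assms(2) by (subst sorted_wrt_iff_nth_Suc_transp)
        (auto simp: ys_def ps(1) less_le)
    moreover have "set ys \<subseteq> S" using ps(2) set_take_subset unfolding ys_def by fast
    moreover have const: "j \<le> K \<Longrightarrow> ps ! j = ps ! i" if "i \<le> j" for j
      using that
    proof (induction rule: dec_induct)
      case (step j)
      then show ?case using ps(4)[of j] by simp
    qed simp
    have "ps = ?f ys"
    proof (rule nth_equalityI)
      fix j assume "j < length ps"
      moreover have "last ys = ps ! i" using len by (simp add: last_conv_nth ys_def flip: length_0_conv)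
      ultimately show "ps ! j = ?f ys ! j"
        using const[of j] ps(1) len by (auto simp: nth_append ys_def)
    qed (use ps(1) len assms(2) in simp)
    ultimately show "ps \<in> ?f ` ?Y" using len by blast
  next
    fix ps assume "ps \<in> ?f ` ?Y"
    then obtain ys where ys: "ps = ?f ys" "sorted_wrt (<) ys" "length ys = Suc i" "set ys \<subseteq> S" by blast
    have nth: "ps ! j = ys ! min j i" if "j \<le> K" for j
      using that ys(3) by (auto simp: ys(1) nth_append last_conv_nth min_def simp flip: length_0_conv)
    have "ps ! j \<le> ps ! Suc j \<and> (ps ! j \<noteq> ps ! Suc j \<longleftrightarrow> j < i)" if "j < K" for j
      using sorted_wrt_nth_less[OF ys(2), of j "Suc j"] ys(3) that
      by (cases "j < i") (auto simp: nth min_def)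
    moreover have "last ys \<in> set ys" using ys(3) by (intro last_in_set) auto
    moreover have "length ps = Suc K" using ys(1,3) assms(2) by simp
    ultimately show "ps \<in> ?D" unfolding D using ys(1,4) by auto
  qed
  moreover have "inj_on ?f ?Y" by (rule inj_onI) simp
  ultimately show ?thesis using card_strictly_sorted_lists[OF assms(1)] by (simp add: card_image)
qed

text \<open>With \<open>wt\<close> written as a sum over \<open>i\<close>, the two sums can be
  exchanged; each \<open>i\<close> then contributes \<open>c i\<close> for every ordered tuple whose
  marks are \<open>staircase K i\<close>.\<close>

lemma sum_weight_staircase:
  fixes S :: "'a :: linorder set" and K :: nat and c :: "nat \<Rightarrow> nat"
  assumes "finite S"
  defines "wt \<equiv> \<lambda>ms. \<Sum>i \<le> K. if ms = staircase K i then c i else 0"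
  shows "(\<Sum>ps | length ps = Suc K \<and> set ps \<subseteq> S. weight wt (replicate K False) ps) =
    (\<Sum>i \<le> K. c i * (card S choose Suc i))"
proof -
  let ?A = "{ps. length ps = Suc K \<and> set ps \<subseteq> S}"
  let ?Q = "\<lambda>i ps. ordered (replicate K False) ps \<and> marks (replicate K False) ps = staircase K i"
  have fin: "finite ?A" using finite_lists_length_eq[OF assms(1), of "Suc K"] by (simp add: conj_commute)
  have "(\<Sum>ps \<in> ?A. weight wt (replicate K False) ps) =
      (\<Sum>ps \<in> ?A. \<Sum>i \<le> K. if ?Q i ps then c i else 0)"
    by (intro sum.cong refl) (simp add: weight_def wt_def)
  also have "\<dots> = (\<Sum>i \<le> K. \<Sum>ps \<in> ?A. if ?Q i ps then c i else 0)"
    by (rule sum.swap)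
  also have "\<dots> = (\<Sum>i \<le> K. c i * (card S choose Suc i))"
  proof (intro sum.cong refl)
    fix i assume "i \<in> {..K}"
    then have i: "i \<le> K" by simp
    have "(\<Sum>ps \<in> ?A. if ?Q i ps then c i else 0) = (\<Sum>ps \<in> {ps \<in> ?A. ?Q i ps}. c i)"
      using fin by (rule sum.inter_filter[symmetric])
    also have "\<dots> = c i * card {ps \<in> ?A. ?Q i ps}" by simp
    also have "{ps \<in> ?A. ?Q i ps} = {ps. length ps = Suc K \<and> set ps \<subseteq> S \<and> ?Q i ps}" by auto
    finally show "(\<Sum>ps \<in> ?A. if ?Q i ps then c i else 0) = c i * (card S choose Suc i)"
      using card_staircase[OF assms(1) i] by simp
  qed
  finally show ?thesis .
qed

text \<open>The system is triangular: the new coefficient multiplies \<open>n choose Suc k\<close>,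
  which vanishes for \<open>n \<le> k\<close>, so the values already placed in \<open>T\<close>
  persist. The index is shifted by one because sets of size \<open>Suc i\<close> belong to
  \<open>staircase K i\<close>.\<close>

lemma ex_coefficients:
  fixes T :: "nat set"
  assumes "infinite T"
  shows "\<exists>c. \<forall>n \<in> {1..k}. (\<Sum>i < k. c i * (n choose Suc i)) \<in> T"
proof (induction k)
  case (Suc k)
  then obtain c where c: "\<forall>n \<in> {1..k}. (\<Sum>i < k. c i * (n choose Suc i)) \<in> T" ..
  let ?s = "\<Sum>i < k. c i * (Suc k choose Suc i)"
  obtain t where t: "t \<in> T" "?s \<le> t"
    using assms by (meson finite_nat_set_iff_bounded not_le)
  \<comment> \<open>Since \<open>Suc k choose Suc k\<close> is 1, this raises the value at
    \<open>Suc k\<close> from \<open>?s\<close> to exactly \<open>t\<close>; the subtraction is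
    exact because \<open>?s \<le> t\<close>.\<close>
  define d where "d = c(k := t - ?s)"
  have d: "(\<Sum>i < Suc k. d i * (n choose Suc i)) =
      (\<Sum>i < k. c i * (n choose Suc i)) + (t - ?s) * (n choose Suc k)" for n
    by (simp add: d_def)
  have "(\<Sum>i < Suc k. d i * (n choose Suc i)) \<in> T" if "n \<in> {1..Suc k}" for n
  proof (cases "n = Suc k")
    case True
    then show ?thesis unfolding d using t by simp
  next
    case False
    then have "n \<in> {1..k}" using that by auto
    then show ?thesis unfolding d using c by (simp add: binomial_eq_0)
  qed
  then show ?case by blast
qed simp

theorem theorem4p3:
  fixes T :: "nat set" and k :: nat
  assumes "T \<subseteq> {n. n \<ge> 1}" and "infinite T" and "k \<ge> 1"
  shows "UP_le k \<subseteq> RC T"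
proof
  fix L assume "L \<in> UP_le k"
  then obtain N :: "(nat, nat) ntm" where N: "nptm N"
    and L: "\<And>x. x \<notin> L \<Longrightarrow> num_acc N x = 0" "\<And>x. x \<in> L \<Longrightarrow> num_acc N x \<in> {1..k}"
    by (auto simp: UP_le_def)
  obtain p where p: "ntm N" "\<And>x. runtime_le N (init N x) (poly p (length x))"
    using N by (auto simp: nptm_iff)
  \<comment> \<open>The \<open>k\<close> copies are the group holding the original input and
    \<open>K\<close> further ones.\<close>
  obtain K where K: "k = Suc K" using assms(3) by (auto dest: Suc_le_D)
  obtain c where c: "\<And>n. n \<in> {1..k} \<Longrightarrow> (\<Sum>i < k. c i * (n choose Suc i)) \<in> T"
    using ex_coefficients[OF assms(2)] by blast
  define wt where "wt = (\<lambda>ms. \<Sum>i \<le> K. if ms = staircase K i then c i else 0)"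
  have wt: "wt ms \<le> (\<Sum>i \<le> K. c i)" for ms
    unfolding wt_def by (intro sum_mono) simp
  let ?P = "prod_ntm N K wt"
  have counts: "counts ?P (init ?P x) (2 * length x + 3 + poly p (length x))
      (\<Sum>i < k. c i * (num_acc N x choose Suc i))" for x
  proof -
    have fin: "finite (codes N (poly p (length x)) (init N x))"
      and card: "card (codes N (poly p (length x)) (init N x)) = num_acc N x"
      using counts_codes[OF p] by (simp_all add: num_acc_eq)
    show ?thesis
      using counts_prod[where wt = wt, OF p(1) wt p(2), where x = x and K = K]
      unfolding sum_weight_staircase[OF fin, of K c, folded wt_def] card K lessThan_Suc_atMost .
  qed
  then have num: "num_acc ?P x = (\<Sum>i < k. c i * (num_acc N x choose Suc i))" for x
    by (simp add: counts_def num_acc_eq)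
  \<comment> \<open>A polynomial that takes the value of the time bound found above.\<close>
  have "poly (p + [:3, 2:]) n = 2 * n + 3 + poly p n" for n by simp
  then have "nptm ?P"
    using counts ntm_prod[where wt = wt, OF p(1) wt] unfolding nptm_iff counts_def by metis
  \<comment> \<open>Without accepting paths of \<open>N\<close> every binomial
    \<open>0 choose Suc i\<close> is 0.\<close>
  moreover have "num_acc ?P x = 0" if "x \<notin> L" for x
    unfolding num L(1)[OF that] by simp
  moreover have "num_acc ?P x \<in> T" if "x \<in> L" for x
    unfolding num by (rule c[OF L(2)[OF that]])
  ultimately show "L \<in> RC T" unfolding RC_def by blast
qed

end
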